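(* Let $k\in\mathbb{N}$, $i\in[k]$ and $N\ge2$. Let $\mathcal{F}$ be a family of $k$-colourings of $E(K_N)$ and let $\mathcal{P}=\mathrm{Forb}(\mathcal{F})$ be $i$-monotone, with $\mathcal{P}_n\neq\emptyset$ for all $n$. Let $p=p(n)$ satisfy $p\gg n^{-1/(2\binom N2-1)}$ and let $T$ be an instance of the $p$-random template $T_{n,p}(i)$. For any fixed $\varepsilon>0$, with high probability \[p\bigl(\mathrm{ex}(n,\mathcal{P})-\varepsilon n^2\bigr)\le\mathrm{ex}(T,\mathcal{P})\le p\bigl(\mathrm{ex}(n,\mathcal{P})+2\varepsilon n^2\bigr).\]
   Context: $K_n$ is the complete graph on $[n]$; a $k$-colouring of $K_n$ is a map $E(K_n)\to[k]$. For $m\le n$, $\binom{K_n}{K_m}$ is the set of order-preserving injections $\phi:[m]\to[n]$; $c_{|\phi}(ij)=c(\phi(i)\phi(j))$. $\mathrm{Forb}(\mathcal{F})_n$ is the set of $k$-colourings $c$ of $K_n$ with $c_{|\phi}\notin\mathcal{F}$ for all $\phi\in\binom{K_n}{K_N}$. The property $\mathcal{P}$ is $i$-monotone if whenever $c\in\mathcal{P}_n$ and $e\in E(K_n)$, the colouring obtained from $c$ by recolouring $e$ with colour $i$ is also in $\mathcal{P}_n$. A template for $K_n$ is $t:E(K_n)\to2^{[k]}\setminus\{\emptyset\}$, $\langle t\rangle$ the set of colourings $c$ with $c(e)\in t(e)$ for all $e$, $\mathrm{Ent}(t)=\sum_e\log_k|t(e)|$, and $\mathrm{ex}(n,\mathcal{P})=\max\{\mathrm{Ent}(t):\langle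 t\rangle\subseteq\mathcal{P}_n\}$. For a template $t$ of $K_n$ with $\langle t\rangle\cap\mathcal{P}_n\neq\emptyset$, $\mathrm{ex}(t,\mathcal{P})=\max\{\mathrm{Ent}(t'): t' \text{ a template of } K_n,\ t'(e)\subseteq t(e)\ \forall e,\ \langle t'\rangle\subseteq\mathcal{P}_n\}$. The $p$-random template $T_{n,p}(i)$ independently sets $T(e)=[k]$ with probability $p$ and $T(e)=\{i\}$ otherwise, for each $e\in E(K_n)$. "With high probability" means with probability tending to $1$ as $n\to\infty$; $f\gg g$ means $f/g\to\infty$. *)

theory Defs
  imports "HOL-Probability.Probability"
begin

definition edges :: "nat \<Rightarrow> nat set set" where
  "edges n = {e. e \<subseteq> {1..n} \<and> card e = 2}"

definition colourings :: "nat \<Rightarrow> nat \<Rightarrow> (nat set \<Rightarrow> nat) set" where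
  "colourings k n = (edges n \<rightarrow>\<^sub>E {1..k})"

definition embeddings :: "nat \<Rightarrow> nat \<Rightarrow> (nat \<Rightarrow> nat) set" where
  "embeddings m n = {\<phi> \<in> {1..m} \<rightarrow>\<^sub>E {1..n}. mono_on {1..m} \<phi> \<and> inj_on \<phi> {1..m}}"

definition pullback :: "nat \<Rightarrow> (nat set \<Rightarrow> nat) \<Rightarrow> (nat \<Rightarrow> nat) \<Rightarrow> nat set \<Rightarrow> nat" where
  "pullback m c \<phi> = (\<lambda>e\<in>edges m. c (\<phi> ` e))"

definition Forb :: "nat \<Rightarrow> nat \<Rightarrow> (nat set \<Rightarrow> nat) set \<Rightarrow> nat \<Rightarrow> (nat set \<Rightarrow> nat) set" where
  "Forb k N F n = {c \<in> colourings k n. \<forall>\<phi>\<in>embeddings N n. pullback N c \<phi> \<notin> F}"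

definition colour_monotone :: "nat \<Rightarrow> (nat \<Rightarrow> (nat set \<Rightarrow> nat) set) \<Rightarrow> bool" where
  "colour_monotone i P \<longleftrightarrow> (\<forall>n. \<forall>c\<in>P n. \<forall>e\<in>edges n. c(e := i) \<in> P n)"

definition templates :: "nat \<Rightarrow> nat \<Rightarrow> (nat set \<Rightarrow> nat set) set" where
  "templates k n = (edges n \<rightarrow>\<^sub>E Pow {1..k} - {{}})"

definition realisations :: "nat \<Rightarrow> nat \<Rightarrow> (nat set \<Rightarrow> nat set) \<Rightarrow> (nat set \<Rightarrow> nat) set" where
  "realisations k n t = {c \<in> colourings k n. \<forall>e\<in>edges n. c e \<in> t e}"

text \<open>For \<open>k = 1\<close> the library convention makes \<open>log 1 1 = 0\<close>, so the entropy is then 0.\<close>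

definition Ent :: "nat \<Rightarrow> nat \<Rightarrow> (nat set \<Rightarrow> nat set) \<Rightarrow> real" where
  "Ent k n t = (\<Sum>e\<in>edges n. log (real k) (real (card (t e))))"

definition ex :: "nat \<Rightarrow> nat \<Rightarrow> (nat \<Rightarrow> (nat set \<Rightarrow> nat) set) \<Rightarrow> real" where
  "ex k n P = Max {Ent k n t | t. t \<in> templates k n \<and> realisations k n t \<subseteq> P n}"

definition ex_rel ::
  "nat \<Rightarrow> nat \<Rightarrow> (nat set \<Rightarrow> nat set) \<Rightarrow> (nat \<Rightarrow> (nat set \<Rightarrow> nat) set) \<Rightarrow> real" where
  "ex_rel k n t P =
     Max {Ent k n t' | t'. t' \<in> templates k n \<and> (\<forall>e\<in>edges n. t' e \<subseteq> t e)
                          \<and> realisations k n t' \<subseteq> P n}"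

text \<open>The default value \<open>undefined\<close> off the edge set puts the support inside \<open>templates k n\<close>.\<close>

definition random_template :: "nat \<Rightarrow> nat \<Rightarrow> real \<Rightarrow> nat \<Rightarrow> (nat set \<Rightarrow> nat set) pmf" where
  "random_template k n p i =
     Pi_pmf (edges n) undefined
       (\<lambda>e. map_pmf (\<lambda>b. if b then {1..k} else {i}) (bernoulli_pmf p))"

end

theory Submission imports Defs begin

text \<open>
  View a template of \<open>K_n\<close> as a set of pairs (edge, colour). The templates all of whose realisations
  lie in \<open>Forb(F)\<close> are exactly those containing no copy of a forbidden colouring, i.e. indep_set
  sets of a hypergraph of uniformity \<open>r = N choose 2\<close> on the pairs. Any two edges of a copy span at
  least three vertices, so two pairs lie in at most \<open>O(1/n)\<close> times as many copies as one pair
  does. A container argument with \<open>\<tau> = n^(-1/(r-1))\<close> then covers all good templates by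
  \<open>exp(O(\<tau> n\<^sup>2 ln n))\<close> container templates with few copies, and by supersaturation each container has
  entropy at most \<open>ex(n, P) + \<epsilon> n\<^sup>2\<close>. Hoeffding's inequality bounds the failure probability for one container
  by \<open>exp(-2 \<epsilon>\<^sup>2 p\<^sup>2 n\<^sup>2)\<close>; since \<open>1/(r-1) > 2/(2r-1)\<close>, the hypothesis on \<open>p\<close> leaves room for the union
  bound. The lower bound intersects an optimal template, enlarged by the colour \<open>i\<close>, with the random one.
\<close>

section \<open>Hypergraph containers\<close>

text \<open>The exponent of \<tau> is dictated by the full copy. Prescribing two or more of its
  pairs leaves at most \<open>n ^ (N - 3)\<close> embeddings, a factor \<open>1 / n\<close> below
  the degree scale \<open>n ^ (N - 2)\<close>, while the container argument asks for a bound
  \<open>\<tau> ^ (l - 1)\<close> on the factor for \<open>l\<close> prescribed pairs;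
  \<open>l = r\<close> is the worst case and requires \<open>\<tau> ^ (r - 1) \<ge> 1 / n\<close>.
  The 2 in the exponent of the hypothesis has another origin: Hoeffding's inequality yields
  \<open>p\<^sup>2\<close> rather than \<open>p\<close>, so \<open>p\<^sup>2\<close> has to beat
  \<tau> times a logarithm. The union bound runs over all containers, so fingerprints are only
  counted, never compared with the random template.

  Containers arise by deletion: a short list inside an independent set determines a set of positive
  proportion that the independent set avoids, and a bounded number of deletions leaves few
  hyperedges.

  Monotonicity enters where an optimal template is cut down to the random one: a closed edge offers
  only the colour \<open>i\<close>, which the optimal template may lack there.\<close>

text \<open>
  A labelled hypergraph of uniformity \<open>r\<close> is a finite set \<open>J\<close> of names of hyperedges, the hyperedge
  \<open>j\<close> having the vertices \<open>\<psi> j 0, \<dots>, \<psi> j (r - 1)\<close>. A hypergraph of smaller uniformity \<open>s\<close> is a subset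
  of \<open>J\<close> of which only the first \<open>s\<close> coordinates are considered; keeping the names retains multiplicities.
\<close>

definition fibre :: "('j \<Rightarrow> nat \<Rightarrow> 'v) \<Rightarrow> 'j set \<Rightarrow> nat set \<Rightarrow> (nat \<Rightarrow> 'v) \<Rightarrow> 'j set" where
  "fibre \<psi> J A u = {j \<in> J. \<forall>a\<in>A. \<psi> j a = u a}"

text \<open>The codegree hypothesis of container arguments, kept by coordinates: \<open>Q\<close> is
  the scale of a vertex degree, and each further prescribed coordinate must save a factor \<tau>, up
  to the common constant \<open>M\<close>.\<close>

definition spread :: "('j \<Rightarrow> nat \<Rightarrow> 'v) \<Rightarrow> nat \<Rightarrow> 'j set \<Rightarrow> real \<Rightarrow> real \<Rightarrow> real \<Rightarrow> bool" where
  "spread \<psi> r J M Q \<tau> \<longleftrightarrow>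
     (\<forall>A u. A \<noteq> {} \<and> A \<subseteq> {..<r} \<longrightarrow> real (card (fibre \<psi> J A u)) \<le> M * Q * \<tau> ^ (card A - 1))"

text \<open>Passing to uniformity \<open>s\<close> lowers the degree scale from \<open>Q\<close> to
  \<open>Q * \<tau>\<close>; the threshold is the codegree
  \<open>(Q * \<tau>) * \<tau> ^ (card A - 1)\<close> belonging to that scale.\<close>

definition saturated :: "('j \<Rightarrow> nat \<Rightarrow> 'v) \<Rightarrow> nat \<Rightarrow> real \<Rightarrow> real \<Rightarrow> 'j set \<Rightarrow> 'j \<Rightarrow> bool" where
  "saturated \<psi> s Q \<tau> G j \<longleftrightarrow>
     (\<exists>A\<subseteq>{..<s}. A \<noteq> {} \<and> Q * \<tau> ^ card A \<le> real (card (fibre \<psi> G A (\<psi> j))))"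

text \<open>Excluding \<open>G\<close> makes each contribution disjoint from what is already
  present, so that sizes add along the list.\<close>

definition fresh_link ::
  "('j \<Rightarrow> nat \<Rightarrow> 'v) \<Rightarrow> 'j set \<Rightarrow> nat \<Rightarrow> real \<Rightarrow> real \<Rightarrow> 'j set \<Rightarrow> 'v \<Rightarrow> 'j set" where
  "fresh_link \<psi> J s Q \<tau> G x = {j \<in> J - G. \<psi> j s = x \<and> \<not> saturated \<psi> s Q \<tau> G j}"

text \<open>
  The \<open>s\<close>-uniform hypergraph generated by the fingerprint \<open>xs\<close>: each vertex in turn (from the end of
  the list) contributes those hyperedges having it as coordinate \<open>s\<close> whose remaining coordinates do not
  yet have too large a degree. If \<open>xs\<close> lies in an independent set, that set stays independent in the shadow.
\<close>

primrec shadow :: "('j \<Rightarrow> nat \<Rightarrow> 'v) \<Rightarrow> 'j set \<Rightarrow> nat \<Rightarrow> real \<Rightarrow> real \<Rightarrow> 'v list \<Rightarrow> 'j set" where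
  "shadow \<psi> J s Q \<tau> [] = {}"
| "shadow \<psi> J s Q \<tau> (x # xs) =
     shadow \<psi> J s Q \<tau> xs \<union> fresh_link \<psi> J s Q \<tau> (shadow \<psi> J s Q \<tau> xs) x"

section \<open>Degrees in shadows and the cost of saturation\<close>

lemma card_UN_le_real:
  assumes "finite X" "\<And>x. x \<in> X \<Longrightarrow> real (card (f x)) \<le> B"
  shows "real (card (\<Union>x\<in>X. f x)) \<le> real (card X) * B"
proof -
  have "real (card (\<Union>x\<in>X. f x)) \<le> real (\<Sum>x\<in>X. card (f x))"
    unfolding of_nat_le_iff by (rule card_UN_le[OF assms(1)])
  also have "\<dots> \<le> (\<Sum>x\<in>X. B)" unfolding of_nat_sum by (intro sum_mono assms(2))
  finally show ?thesis by simp
qed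

lemma fibre_subset: "fibre \<psi> J A u \<subseteq> J"
  by (auto simp: fibre_def)

lemma finite_fibre: "finite J \<Longrightarrow> finite (fibre \<psi> J A u)"
  by (rule finite_subset[OF fibre_subset])

lemma spreadD:
  "\<lbrakk>spread \<psi> r J M Q \<tau>; A \<noteq> {}; A \<subseteq> {..<r}\<rbrakk> \<Longrightarrow>
    real (card (fibre \<psi> J A u)) \<le> M * Q * \<tau> ^ (card A - 1)"
  by (auto simp: spread_def)

lemma spread_mono:
  assumes "spread \<psi> r J M Q \<tau>" "G \<subseteq> J" "finite J"
  shows "spread \<psi> r G M Q \<tau>"
  unfolding spread_def
proof (intro allI impI)
  fix A u assume A: "A \<noteq> {} \<and> A \<subseteq> {..<r}"
  have "card (fibre \<psi> G A u) \<le> card (fibre \<psi> J A u)"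
    using assms(2,3) by (intro card_mono finite_fibre) (auto simp: fibre_def)
  with spreadD[OF assms(1), of A u] A
  show "real (card (fibre \<psi> G A u)) \<le> M * Q * \<tau> ^ (card A - 1)" by linarith
qed

lemma shadow_subset: "shadow \<psi> J s Q \<tau> xs \<subseteq> J"
  by (induction xs) (auto simp: fresh_link_def)

lemma shadow_coordinate: "j \<in> shadow \<psi> J s Q \<tau> xs \<Longrightarrow> \<psi> j s \<in> set xs"
  by (induction xs) (auto simp: fresh_link_def)

text \<open>A fibre over \<open>A\<close> grows only while it is below the threshold
  \<open>Q * \<tau> ^ card A\<close>, and one vertex adds at most the codegree of
  \<open>insert s A\<close> in \<open>J\<close>, that is \<open>M * Q * \<tau> ^ card A\<close>. The
  overshoot is thus a single such term, whence the constant \<open>M + 1\<close>.\<close>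

lemma spread_shadow:
  assumes J: "finite J" and sp: "spread \<psi> (Suc s) J M Q \<tau>"
    and pos: "M > 0" "Q > 0" "\<tau> > 0"
  shows "spread \<psi> s (shadow \<psi> J s Q \<tau> xs) (M + 1) (Q * \<tau>) \<tau>"
  unfolding spread_def
proof (intro allI impI)
  fix A u assume A: "A \<noteq> {} \<and> A \<subseteq> {..<s}"
  then have finA: "finite A" using finite_subset by blast
  have sA: "s \<notin> A" using A by auto
  have cA: "card A \<ge> 1" using A finA by (simp add: Suc_leI card_gt_0_iff)
  have pw: "(M + 1) * (Q * \<tau>) * \<tau> ^ (card A - 1) = (M + 1) * (Q * \<tau> ^ card A)"
    using cA by (cases "card A") auto
  have "real (card (fibre \<psi> (shadow \<psi> J s Q \<tau> xs) A u)) \<le> (M + 1) * (Q * \<tau> ^ card A)"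
  proof (induction xs)
    case Nil
    have "fibre \<psi> {} A u = {}" by (auto simp: fibre_def)
    then show ?case using pos by simp
  next
    case (Cons x xs)
    let ?G = "shadow \<psi> J s Q \<tau> xs" and ?L = "fresh_link \<psi> J s Q \<tau> (shadow \<psi> J s Q \<tau> xs) x"
    have finG: "finite ?G" using J shadow_subset finite_subset by metis
    have un: "fibre \<psi> (?G \<union> ?L) A u = fibre \<psi> ?G A u \<union> fibre \<psi> ?L A u"
      by (auto simp: fibre_def)
    show ?case
    proof (cases "fibre \<psi> ?L A u = {}")
      case True
      then show ?thesis using Cons un by simp
    next
      case False
      then obtain j where j: "j \<in> ?L" "\<forall>a\<in>A. \<psi> j a = u a" by (auto simp: fibre_def)
      have eq: "fibre \<psi> ?G A u = fibre \<psi> ?G A (\<psi> j)" using j by (auto simp: fibre_def)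
      have lt: "real (card (fibre \<psi> ?G A u)) < Q * \<tau> ^ card A"
      proof -
        have "\<not> saturated \<psi> s Q \<tau> ?G j" using j(1) by (simp add: fresh_link_def)
        then have "\<not> Q * \<tau> ^ card A \<le> real (card (fibre \<psi> ?G A (\<psi> j)))"
          using A unfolding saturated_def by blast
        then show ?thesis by (simp add: eq)
      qed
      have "fibre \<psi> ?L A u \<subseteq> fibre \<psi> J (insert s A) (u(s := x))"
        using sA by (auto simp: fibre_def fresh_link_def)
      then have "card (fibre \<psi> ?L A u) \<le> card (fibre \<psi> J (insert s A) (u(s := x)))"
        by (intro card_mono finite_fibre J)
      also have "real \<dots> \<le> M * Q * \<tau> ^ (card (insert s A) - 1)"
        using A by (intro spreadD[OF sp]) auto
      also have "card (insert s A) - 1 = card A" using finA sA by simp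
      finally have le: "real (card (fibre \<psi> ?L A u)) \<le> M * Q * \<tau> ^ card A" by simp
      have "card (fibre \<psi> (?G \<union> ?L) A u) \<le> card (fibre \<psi> ?G A u) + card (fibre \<psi> ?L A u)"
        unfolding un by (rule card_Un_le)
      then show ?thesis using lt le by (simp add: algebra_simps)
    qed
  qed
  then show "real (card (fibre \<psi> (shadow \<psi> J s Q \<tau> xs) A u)) \<le> (M + 1) * (Q * \<tau>) * \<tau> ^ (card A - 1)"
    by (simp only: pw)
qed

lemma card_le_spread:
  assumes V: "finite V" and J: "finite J" and "r > 0" and sp: "spread \<psi> r J M Q \<tau>"
    and inV: "\<And>j. j \<in> J \<Longrightarrow> \<psi> j 0 \<in> V"
  shows "real (card J) \<le> real (card V) * (M * Q)"
proof -
  have "J \<subseteq> (\<Union>y\<in>V. fibre \<psi> J {0} (\<lambda>_. y))"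
    using inV by (auto simp: fibre_def)
  then have "card J \<le> card (\<Union>y\<in>V. fibre \<psi> J {0} (\<lambda>_. y))"
    by (intro card_mono finite_UN_I V finite_fibre J)
  also have "real \<dots> \<le> real (card V) * (M * Q)"
  proof (rule card_UN_le_real[OF V])
    fix y
    show "real (card (fibre \<psi> J {0} (\<lambda>_. y))) \<le> M * Q"
      using spreadD[OF sp, of "{0}" "\<lambda>_. y"] \<open>r > 0\<close> by simp
  qed
  finally show ?thesis by simp
qed

text \<open>Take a longest list in \<open>I\<close> all of whose entries contribute at least \<open>b\<close> hyperedges on average.\<close>

lemma exists_fingerprint:
  assumes J: "finite J" and b: "b > 0"
  shows "\<exists>xs. set xs \<subseteq> I \<and> b * real (length xs) \<le> real (card (shadow \<psi> J s Q \<tau> xs)) \<and>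
     (\<forall>x\<in>I. real (card (fresh_link \<psi> J s Q \<tau> (shadow \<psi> J s Q \<tau> xs) x)) < b)"
proof -
  let ?P = "\<lambda>xs. set xs \<subseteq> I \<and> b * real (length xs) \<le> real (card (shadow \<psi> J s Q \<tau> xs))"
  have "length xs \<le> nat \<lfloor>real (card J) / b\<rfloor>" if "?P xs" for xs
  proof -
    have "card (shadow \<psi> J s Q \<tau> xs) \<le> card J"
      by (rule card_mono[OF J shadow_subset])
    then have "b * real (length xs) \<le> real (card J)" using that by linarith
    then have "real (length xs) \<le> real (card J) / b" using b by (simp add: field_simps)
    then show ?thesis by (simp add: le_nat_floor)
  qed
  then have bd: "\<forall>xs. ?P xs \<longrightarrow> length xs < Suc (nat \<lfloor>real (card J) / b\<rfloor>)"
    by (simp add: less_Suc_eq_le)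
  have "?P []" by simp
  from ex_has_greatest_nat[of ?P, OF this bd] obtain xs where xs: "?P xs" and mx: "\<And>ys. ?P ys \<Longrightarrow> length ys \<le> length xs"
    by blast
  let ?G = "shadow \<psi> J s Q \<tau> xs"
  have "real (card (fresh_link \<psi> J s Q \<tau> ?G x)) < b" if "x \<in> I" for x
  proof (rule ccontr)
    assume c: "\<not> ?thesis"
    have fin: "finite ?G" "finite (fresh_link \<psi> J s Q \<tau> ?G x)"
      using J shadow_subset finite_subset by (metis, auto simp: fresh_link_def)
    have "card (shadow \<psi> J s Q \<tau> (x # xs)) = card ?G + card (fresh_link \<psi> J s Q \<tau> ?G x)"
      using fin by (simp add: card_Un_disjoint fresh_link_def disjoint_iff)
    then have "?P (x # xs)" using xs c that by (simp add: algebra_simps)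
    from mx[OF this] show False by simp
  qed
  with xs show ?thesis by blast
qed

text \<open>For fixed \<open>A\<close>, saturated patterns have disjoint fibres in \<open>G\<close>
  of size at least \<open>Q * \<tau> ^ card A\<close>, so there are at most
  \<open>card G / (Q * \<tau> ^ card A)\<close> of them, and each blocks at most
  \<open>M * Q * \<tau> ^ (card A - 1)\<close> hyperedges of \<open>J\<close>. The product does not
  depend on \<open>A\<close>, for which there are at most \<open>2 ^ s\<close> choices.\<close>

lemma card_saturated_le:
  assumes J: "finite J" and G: "G \<subseteq> J" and sp: "spread \<psi> (Suc s) J M Q \<tau>"
    and pos: "M > 0" "Q > 0" "\<tau> > 0"
  shows "real (card {j \<in> J. saturated \<psi> s Q \<tau> G j}) \<le> 2 ^ s * (real (card G) * M / \<tau>)"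
proof -
  let ?S = "\<lambda>A. {j \<in> J. Q * \<tau> ^ card A \<le> real (card (fibre \<psi> G A (\<psi> j)))}"
  let ?\<A> = "Pow {..<s} - {{}}"
  have one: "real (card (?S A)) \<le> real (card G) * M / \<tau>" if A: "A \<in> ?\<A>" for A
  proof -
    \<comment> \<open>Restriction to \<open>A\<close> makes distinct patterns differ on
      \<open>A\<close>, hence have disjoint fibres.\<close>
    define U where "U = (\<lambda>j. restrict (\<psi> j) A) ` ?S A"
    have finU: "finite U" using J by (simp add: U_def)
    have finG: "finite G" using J G finite_subset by blast
    have finA: "finite A" using A finite_subset by blast
    have cA: "card A \<ge> 1" using A finA by (simp add: Suc_leI card_gt_0_iff)
    have fib: "fibre \<psi> G A (restrict (\<psi> j) A) = fibre \<psi> G A (\<psi> j)" for j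
      by (auto simp: fibre_def)
    have "?S A \<subseteq> (\<Union>u\<in>U. fibre \<psi> J A u)"
      by (auto simp: U_def fibre_def)
    then have "card (?S A) \<le> card (\<Union>u\<in>U. fibre \<psi> J A u)"
      by (intro card_mono finite_UN_I finU finite_fibre J)
    also have "real \<dots> \<le> real (card U) * (M * Q * \<tau> ^ (card A - 1))"
      using A by (intro card_UN_le_real[OF finU] spreadD[OF sp]) auto
    finally have 1: "real (card (?S A)) \<le> real (card U) * (M * Q * \<tau> ^ (card A - 1))" by simp
    have "real (card U) * (Q * \<tau> ^ card A) = (\<Sum>u\<in>U. Q * \<tau> ^ card A)" by simp
    also have "\<dots> \<le> (\<Sum>u\<in>U. real (card (fibre \<psi> G A u)))"
      by (intro sum_mono) (auto simp: U_def fib)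
    also have "\<dots> = real (card (\<Union>u\<in>U. fibre \<psi> G A u))"
    proof -
      have "fibre \<psi> G A u \<inter> fibre \<psi> G A w = {}" if "u \<in> U" "w \<in> U" "u \<noteq> w" for u w
      proof -
        have "u \<in> extensional A" "w \<in> extensional A" using that by (auto simp: U_def)
        then obtain a where "a \<in> A" "u a \<noteq> w a" using \<open>u \<noteq> w\<close> extensionalityI by blast
        then show ?thesis by (auto simp: fibre_def)
      qed
      then have "card (\<Union>u\<in>U. fibre \<psi> G A u) = (\<Sum>u\<in>U. card (fibre \<psi> G A u))"
        by (intro card_UN_disjoint finU) (auto simp: finite_fibre finG)
      then show ?thesis by simp
    qed
    also have "\<dots> \<le> real (card G)"
      unfolding of_nat_le_iff by (intro card_mono finG) (auto simp: fibre_def)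
    finally have 2: "real (card U) * (Q * \<tau> ^ card A) \<le> real (card G)" .
    have "real (card U) * (M * Q * \<tau> ^ (card A - 1)) = real (card U) * (Q * \<tau> ^ card A) * (M / \<tau>)"
      using cA pos by (cases "card A") (auto simp: field_simps)
    also have "\<dots> \<le> real (card G) * (M / \<tau>)"
      using 2 pos by (intro mult_right_mono) auto
    finally show ?thesis using 1 by simp
  qed
  have "{j \<in> J. saturated \<psi> s Q \<tau> G j} \<subseteq> (\<Union>A\<in>?\<A>. ?S A)"
    by (auto simp: saturated_def)
  then have "card {j \<in> J. saturated \<psi> s Q \<tau> G j} \<le> card (\<Union>A\<in>?\<A>. ?S A)"
    using J by (intro card_mono) auto
  also have "real \<dots> \<le> real (card ?\<A>) * (real (card G) * M / \<tau>)"
    by (intro card_UN_le_real one) auto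
  also have "\<dots> \<le> 2 ^ s * (real (card G) * M / \<tau>)"
  proof (intro mult_right_mono)
    have "card ?\<A> \<le> card (Pow {..<s})" by (intro card_mono) auto
    then have "card ?\<A> \<le> 2 ^ s" by (simp only: card_Pow finite_lessThan card_lessThan)
    then show "real (card ?\<A>) \<le> 2 ^ s" by (metis of_nat_le_iff of_nat_numeral of_nat_power)
  qed (use pos in auto)
  finally show ?thesis by simp
qed

text \<open>A hyperedge outside \<open>G\<close> that is not saturated lies in the fresh link of its
  own coordinate \<open>s\<close>. Vertices with a large fresh link are charged their full degree,
  the others at most \<open>b\<close>. For small \<open>G\<close> this forces many vertices with a
  large fresh link.\<close>

lemma card_le_via_links:
  assumes V: "finite V" and J: "finite J" and inV: "\<And>j. j \<in> J \<Longrightarrow> \<psi> j s \<in> V"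
    and G: "G \<subseteq> J" and sp: "spread \<psi> (Suc s) J M Q \<tau>"
    and pos: "M > 0" "Q > 0" "\<tau> > 0" "b \<ge> 0"
  shows "real (card J) \<le> real (card {x \<in> V. b \<le> real (card (fresh_link \<psi> J s Q \<tau> G x))}) * (M * Q)
     + real (card V) * b + real (card G) + 2 ^ s * (real (card G) * M / \<tau>)"
proof -
  let ?X = "{x \<in> V. b \<le> real (card (fresh_link \<psi> J s Q \<tau> G x))}"
  let ?L = "fresh_link \<psi> J s Q \<tau> G"
  let ?S = "{j \<in> J. saturated \<psi> s Q \<tau> G j}"
  have finG: "finite G" using J G finite_subset by blast
  have finL: "finite (?L x)" for x using J by (auto simp: fresh_link_def)
  have sub: "J \<subseteq> (\<Union>x\<in>?X. fibre \<psi> J {s} (\<lambda>_. x)) \<union> (\<Union>x\<in>V - ?X. ?L x) \<union> G \<union> ?S"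
  proof
    fix j assume j: "j \<in> J"
    show "j \<in> (\<Union>x\<in>?X. fibre \<psi> J {s} (\<lambda>_. x)) \<union> (\<Union>x\<in>V - ?X. ?L x) \<union> G \<union> ?S"
    proof (cases "j \<in> G \<or> j \<in> ?S")
      case False
      then have "j \<in> ?L (\<psi> j s)" using j by (auto simp: fresh_link_def)
      moreover have "j \<in> fibre \<psi> J {s} (\<lambda>_. \<psi> j s)" using j by (auto simp: fibre_def)
      ultimately show ?thesis using inV[OF j] by blast
    qed auto
  qed
  have c1: "real (card (\<Union>x\<in>?X. fibre \<psi> J {s} (\<lambda>_. x))) \<le> real (card ?X) * (M * Q)"
  proof (rule card_UN_le_real)
    fix x show "real (card (fibre \<psi> J {s} (\<lambda>_. x))) \<le> M * Q"
      using spreadD[OF sp, of "{s}" "\<lambda>_. x"] by simp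
  qed (use V in simp)
  have c2: "real (card (\<Union>x\<in>V - ?X. ?L x)) \<le> real (card V) * b"
  proof -
    have "real (card (\<Union>x\<in>V - ?X. ?L x)) \<le> real (card (V - ?X)) * b"
      using V by (intro card_UN_le_real) auto
    also have "\<dots> \<le> real (card V) * b"
      using V pos by (intro mult_right_mono) (auto intro!: card_mono)
    finally show ?thesis by simp
  qed
  have "card J \<le> card ((\<Union>x\<in>?X. fibre \<psi> J {s} (\<lambda>_. x)) \<union> (\<Union>x\<in>V - ?X. ?L x) \<union> G \<union> ?S)"
    using V J finG finL by (intro card_mono sub) (auto intro!: finite_fibre)
  also have "\<dots> \<le> card (\<Union>x\<in>?X. fibre \<psi> J {s} (\<lambda>_. x)) + card (\<Union>x\<in>V - ?X. ?L x) + card G + card ?S"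
    using card_Un_le[of "(\<Union>x\<in>?X. fibre \<psi> J {s} (\<lambda>_. x))" "\<Union>x\<in>V - ?X. ?L x"]
      card_Un_le[of "(\<Union>x\<in>?X. fibre \<psi> J {s} (\<lambda>_. x)) \<union> (\<Union>x\<in>V - ?X. ?L x)" G]
      card_Un_le[of "(\<Union>x\<in>?X. fibre \<psi> J {s} (\<lambda>_. x)) \<union> (\<Union>x\<in>V - ?X. ?L x) \<union> G" ?S]
    by linarith
  finally have "real (card J) \<le> real (card (\<Union>x\<in>?X. fibre \<psi> J {s} (\<lambda>_. x)))
      + real (card (\<Union>x\<in>V - ?X. ?L x)) + real (card G) + real (card ?S)"
    by linarith
  then show ?thesis
    using c1 c2 card_saturated_le[OF J G sp pos(1-3)] by linarith
qed

section \<open>Large sets avoided by an independent set\<close>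

lemma card_short_lists_le:
  assumes "finite V"
  shows "card {xs. set xs \<subseteq> V \<and> length xs \<le> q} \<le> (card V + 1) ^ q"
proof -
  have "(\<Sum>i\<le>q. v ^ i) \<le> (v + 1) ^ q" for v :: nat
  proof (induction q)
    case (Suc q)
    have "v ^ Suc q \<le> v * (v + 1) ^ q" 
      unfolding power_Suc by (intro mult_le_mono power_mono) auto
    with Suc have "(\<Sum>i\<le>q. v ^ i) + v ^ Suc q \<le> (v + 1) ^ q + v * (v + 1) ^ q" by (rule add_mono)
    then show ?case by simp
  qed simp
  then show ?thesis using card_lists_length_le[OF assms] by simp
qed

definition indep_set :: "('j \<Rightarrow> nat \<Rightarrow> 'v) \<Rightarrow> nat \<Rightarrow> 'j set \<Rightarrow> 'v set \<Rightarrow> bool" where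
  "indep_set \<psi> r J I \<longleftrightarrow> (\<forall>j\<in>J. \<exists>a<r. \<psi> j a \<notin> I)"

text \<open>The family does not depend on \<open>I\<close>, so it can be counted. Keeping
  \<open>R\<close> among the vertices covered by \<open>J\<close> ensures that, for \<open>J\<close>
  restricted to a container \<open>C\<close>, deleting \<open>R\<close> really shrinks
  \<open>C\<close>.\<close>

definition deleting_family ::
  "('j \<Rightarrow> nat \<Rightarrow> 'v) \<Rightarrow> nat \<Rightarrow> 'v set \<Rightarrow> 'j set \<Rightarrow> real \<Rightarrow> real \<Rightarrow> 'v set set \<Rightarrow> bool" where
  "deleting_family \<psi> r V J \<delta> B \<R> \<longleftrightarrow> finite \<R> \<and> real (card \<R>) \<le> B \<and>
     (\<forall>R\<in>\<R>. \<delta> * real (card V) \<le> real (card R) \<and> R \<subseteq> (\<Union>j\<in>J. \<psi> j ` {..<r})) \<and>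
     (\<forall>I\<subseteq>V. indep_set \<psi> r J I \<longrightarrow> (\<exists>R\<in>\<R>. R \<inter> I = {}))"

definition spread_hypergraph ::
  "('j \<Rightarrow> nat \<Rightarrow> 'v) \<Rightarrow> nat \<Rightarrow> 'v set \<Rightarrow> 'j set \<Rightarrow> real \<Rightarrow> real \<Rightarrow> real \<Rightarrow> bool" where
  "spread_hypergraph \<psi> r V J M Q \<tau> \<longleftrightarrow> finite V \<and> finite J \<and> (\<forall>j\<in>J. \<forall>a<r. \<psi> j a \<in> V) \<and>
     0 < Q \<and> 0 < \<tau> \<and> \<tau> \<le> 1 \<and> spread \<psi> r J M Q \<tau>"

text \<open>In uniformity 1 an independent set misses every vertex occurring in a hyperedge, so a
  single set serves all of them; the degree bound \<open>M * Q\<close> shows that it is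
  large.\<close>

lemma deleting_family_uniform_1:
  fixes \<psi> :: "'j \<Rightarrow> nat \<Rightarrow> 'v"
  assumes M: "M > 0" and H: "spread_hypergraph \<psi> 1 V J M Q \<tau>"
    and big: "\<gamma> * Q * real (card V) \<le> real (card J)"
  shows "deleting_family \<psi> 1 V J (\<gamma> / M) 1 {(\<lambda>j. \<psi> j 0) ` J}"
  unfolding deleting_family_def
proof (intro conjI)
  let ?R = "(\<lambda>j. \<psi> j 0) ` J"
  have H': "finite V" "finite J" "\<forall>j\<in>J. \<forall>a<1. \<psi> j a \<in> V" "0 < Q" "spread \<psi> 1 J M Q \<tau>"
    using H by (auto simp: spread_hypergraph_def)
  have "real (card J) \<le> real (card ?R) * (M * Q)"
    by (rule card_le_spread[where r = 1]) (use H' in auto)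
  then have "\<gamma> * Q * real (card V) \<le> real (card ?R) * (M * Q)" using big by linarith
  then have "\<gamma> / M * real (card V) \<le> real (card ?R)"
    using M \<open>0 < Q\<close> by (simp add: field_simps)
  then show "\<forall>R\<in>{?R}. \<gamma> / M * real (card V) \<le> real (card R) \<and> R \<subseteq> (\<Union>j\<in>J. \<psi> j ` {..<1})"
    by auto
  show "\<forall>I\<subseteq>V. indep_set \<psi> 1 J I \<longrightarrow> (\<exists>R\<in>{?R}. R \<inter> I = {})"
    by (auto simp: indep_set_def)
qed auto

text \<open>
  Induction on the uniformity. If the shadow of the fingerprint has many hyperedges, recurse on it;
  otherwise few hyperedges are blocked, so many vertices still have a large fresh link, and by
  maximality of the fingerprint none of these belongs to the independent set.
\<close>

lemma deleting_family_exists: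
  assumes "M > 0" "\<gamma> > 0"
  shows "\<exists>\<delta>>0. \<exists>K\<ge>0. \<forall>V J Q \<tau>. spread_hypergraph \<psi> (Suc s) V J M Q \<tau> \<longrightarrow>
     \<gamma> * Q * real (card V) \<le> real (card J) \<longrightarrow>
     (\<exists>\<R>. deleting_family \<psi> (Suc s) V J \<delta> (real (card V + 1) powr (K * \<tau> * real (card V))) \<R>)"
  using assms
proof (induction s arbitrary: M \<gamma>)
  case 0
  have "\<exists>\<R>. deleting_family \<psi> (Suc 0) V J (\<gamma> / M) (real (card V + 1) powr (0 * \<tau> * real (card V))) \<R>"
    if "spread_hypergraph \<psi> (Suc 0) V J M Q \<tau>" "\<gamma> * Q * real (card V) \<le> real (card J)" for V J Q \<tau>
    using deleting_family_uniform_1[OF 0(1), of \<psi> V J Q \<tau> \<gamma>] that by auto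
  with 0 show ?case
    by (intro exI[of _ "\<gamma> / M"] conjI exI[of _ "0::real"]) auto
next
  case (Suc s)
  define m where "m = Suc s"
  \<comment> \<open>Chosen so that a sparse shadow and the hyperedges it saturates account together
    for at most \<open>\<gamma> / 4 * Q * card V\<close> hyperedges.\<close>
  define \<gamma>' where "\<gamma>' = \<gamma> / (4 * (1 + 2 ^ m * M))"
  have \<gamma>': "\<gamma>' > 0" using Suc.prems by (simp add: \<gamma>'_def add_pos_pos)
  from Suc.IH[of "M + 1" \<gamma>'] Suc.prems \<gamma>' obtain \<delta>' K' where \<delta>': "\<delta>' > 0" and K': "K' \<ge> 0" and
    IH: "\<And>V J Q \<tau>. spread_hypergraph \<psi> m V J (M + 1) Q \<tau> \<Longrightarrow> \<gamma>' * Q * real (card V) \<le> real (card J) \<Longrightarrow>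
      (\<exists>\<R>. deleting_family \<psi> m V J \<delta>' (real (card V + 1) powr (K' * \<tau> * real (card V))) \<R>)"
    unfolding m_def by (metis add_pos_pos zero_less_one)
  \<comment> \<open>Of \<open>\<gamma> * Q * card V\<close> hyperedges a quarter goes to small fresh
    links and a quarter to the shadow and saturation; the remaining half needs
    \<open>\<gamma> / (2 * M) * card V\<close> vertices of degree at most
    \<open>M * Q\<close>.\<close>
  define \<delta> where "\<delta> = min \<delta>' (\<gamma> / (2 * M))"
  \<comment> \<open>The second summand pays for the list: its entries contribute at least
    \<open>\<gamma> * Q / 4\<close> hyperedges each on average, while the degrees allow the shadow
    at most \<open>card V * (M + 1) * Q * \<tau>\<close>.\<close>
  define K where "K = K' + 4 * (M + 1) / \<gamma>"
  have \<delta>: "\<delta> > 0" using \<delta>' Suc.prems by (simp add: \<delta>_def)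
  have K: "K \<ge> 0" using K' Suc.prems by (simp add: K_def)
  have "\<exists>\<R>. deleting_family \<psi> (Suc m) V J \<delta> (real (card V + 1) powr (K * \<tau> * real (card V))) \<R>"
    if H: "spread_hypergraph \<psi> (Suc m) V J M Q \<tau>" and big: "\<gamma> * Q * real (card V) \<le> real (card J)"
    for V J Q \<tau>
  proof -
    have V: "finite V" and J: "finite J" and inV: "\<And>j a. j \<in> J \<Longrightarrow> a < Suc m \<Longrightarrow> \<psi> j a \<in> V"
      and Q: "0 < Q" and \<tau>: "0 < \<tau>" "\<tau> \<le> 1" and sp: "spread \<psi> (Suc m) J M Q \<tau>"
      using H by (auto simp: spread_hypergraph_def)
    define b where "b = \<gamma> * Q / 4"
    have b: "b > 0" using Suc.prems Q by (simp add: b_def)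
    define v where "v = real (card V)"
    define q where "q = nat \<lfloor>4 * (M + 1) / \<gamma> * \<tau> * v\<rfloor>"
    define X where "X = {xs. set xs \<subseteq> V \<and> length xs \<le> q}"
    define S where "S = shadow \<psi> J m Q \<tau>"
    define D where "D xs = {x \<in> V. b \<le> real (card (fresh_link \<psi> J m Q \<tau> (S xs) x))}" for xs
    define B where "B = real (card V + 1) powr (K' * \<tau> * v)"
    have v0: "v \<ge> 0" by (simp add: v_def)
    have B1: "B \<ge> 1" unfolding B_def using K' \<tau> v0 by (intro ge_one_powr_ge_zero) auto
    have SJ: "S xs \<subseteq> J" for xs unfolding S_def by (rule shadow_subset)
    have finS: "finite (S xs)" for xs using SJ J finite_subset by metis
    have spS: "spread \<psi> m (S xs) (M + 1) (Q * \<tau>) \<tau>" for xs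
      unfolding S_def using spread_shadow[OF J sp] Suc.prems Q \<tau> by auto
    have hS: "spread_hypergraph \<psi> m V (S xs) (M + 1) (Q * \<tau>) \<tau>" for xs
      using V finS spS Q \<tau> inV SJ unfolding spread_hypergraph_def
      by (metis (no_types) less_SucI mult_pos_pos subsetD)
    \<comment> \<open>One family per list, defined without reference to an independent set. Both
      cases are bounded by \<open>B\<close>, so the total is at most \<open>B\<close> times the
      number of short lists.\<close>
    have "\<exists>\<R>. finite \<R> \<and> real (card \<R>) \<le> B \<and>
        (if \<gamma>' * (Q * \<tau>) * v \<le> real (card (S xs)) then deleting_family \<psi> m V (S xs) \<delta>' B \<R>
         else \<R> = {D xs})" for xs
    proof (cases "\<gamma>' * (Q * \<tau>) * v \<le> real (card (S xs))")
      case True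
      with IH[OF hS[of xs]] obtain \<R> where "deleting_family \<psi> m V (S xs) \<delta>' B \<R>"
        unfolding B_def v_def by blast
      with True show ?thesis unfolding deleting_family_def by metis
    next
      case False
      then show ?thesis using B1 by (intro exI[of _ "{D xs}"]) simp
    qed
    then obtain \<R>' where fin\<R>: "\<And>xs. finite (\<R>' xs)" and card\<R>: "\<And>xs. real (card (\<R>' xs)) \<le> B"
      and \<R>': "\<And>xs. if \<gamma>' * (Q * \<tau>) * v \<le> real (card (S xs)) then deleting_family \<psi> m V (S xs) \<delta>' B (\<R>' xs)
         else \<R>' xs = {D xs}" by metis
    let ?\<R> = "\<Union>xs\<in>X. \<R>' xs"
    have finX: "finite X" unfolding X_def by (rule finite_lists_length_le[OF V])
    have "deleting_family \<psi> (Suc m) V J \<delta> (real (card V + 1) powr (K * \<tau> * v)) ?\<R>"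
      unfolding deleting_family_def
    proof (intro conjI)
      show "finite ?\<R>" using finX fin\<R> by blast
      have "real (card ?\<R>) \<le> real (card X) * B" by (rule card_UN_le_real[OF finX card\<R>])
      also have "\<dots> \<le> real ((card V + 1) ^ q) * B"
        using B1 card_short_lists_le[OF V, of q] unfolding X_def
        by (intro mult_right_mono) (simp_all only: of_nat_le_iff)
      also have "real ((card V + 1) ^ q) = real (card V + 1) powr real q"
        unfolding of_nat_power by (rule powr_realpow[symmetric]) simp
      also have "\<dots> * B \<le> real (card V + 1) powr (4 * (M + 1) / \<gamma> * \<tau> * v) * B"
      proof (intro mult_right_mono powr_mono)
        show "real q \<le> 4 * (M + 1) / \<gamma> * \<tau> * v"
          unfolding q_def using Suc.prems \<tau> v0 by (intro of_nat_floor) simp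
      qed (use B1 in auto)
      also have "\<dots> = real (card V + 1) powr (K * \<tau> * v)"
        unfolding B_def K_def by (simp add: powr_add[symmetric] algebra_simps)
      finally show "real (card ?\<R>) \<le> real (card V + 1) powr (K * \<tau> * v)" .
      show "\<forall>R\<in>?\<R>. \<delta> * real (card V) \<le> real (card R) \<and> R \<subseteq> (\<Union>j\<in>J. \<psi> j ` {..<Suc m})"
      proof
        fix R assume "R \<in> ?\<R>"
        then obtain xs where xs: "R \<in> \<R>' xs" by blast
        show "\<delta> * real (card V) \<le> real (card R) \<and> R \<subseteq> (\<Union>j\<in>J. \<psi> j ` {..<Suc m})"
        proof (cases "\<gamma>' * (Q * \<tau>) * v \<le> real (card (S xs))")
          case True
          then have "\<delta>' * real (card V) \<le> real (card R)" "R \<subseteq> (\<Union>j\<in>S xs. \<psi> j ` {..<m})"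
            using \<R>'[of xs] xs by (auto simp: deleting_family_def)
          moreover have "\<delta> * real (card V) \<le> \<delta>' * real (card V)"
            by (intro mult_right_mono) (auto simp: \<delta>_def)
          ultimately show ?thesis using SJ[of xs] by fastforce
        next
          case False
          then have R: "R = D xs" using \<R>'[of xs] xs by auto
          let ?g = "real (card (S xs))"
          have cnt: "real (card J) \<le> real (card (D xs)) * (M * Q) + v * b + ?g + 2 ^ m * (?g * M / \<tau>)"
            unfolding D_def v_def using card_le_via_links[OF V J _ SJ sp] inV Suc.prems Q \<tau> b by simp
          have g1: "?g \<le> \<gamma>' * (Q * \<tau>) * v" using False by simp
          have g2: "?g \<le> \<gamma>' * Q * v"
          proof -
            have "\<gamma>' * (Q * \<tau>) * v \<le> \<gamma>' * (Q * 1) * v"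
              using \<gamma>' Q \<tau> v0 by (intro mult_right_mono mult_left_mono) auto
            then show ?thesis using g1 by simp
          qed
          have g3: "2 ^ m * (?g * M / \<tau>) \<le> 2 ^ m * (\<gamma>' * Q * v * M)"
          proof (intro mult_left_mono)
            have "?g / \<tau> \<le> \<gamma>' * Q * v" using g1 \<tau> by (simp add: field_simps)
            then have "?g / \<tau> * M \<le> \<gamma>' * Q * v * M" using Suc.prems by (intro mult_right_mono) auto
            then show "?g * M / \<tau> \<le> \<gamma>' * Q * v * M" by simp
          qed simp
          have pos: "1 + 2 ^ m * M > 0" using Suc.prems by (simp add: add_pos_pos)
          have "\<gamma>' * Q * v + 2 ^ m * (\<gamma>' * Q * v * M) = \<gamma>' * (1 + 2 ^ m * M) * Q * v"
            by (simp add: algebra_simps)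
          also have "\<gamma>' * (1 + 2 ^ m * M) = \<gamma> / 4"
            using pos unfolding \<gamma>'_def by (simp add: field_simps)
          finally have "?g + 2 ^ m * (?g * M / \<tau>) \<le> \<gamma> / 4 * Q * v" using g2 g3 by linarith
          moreover have "v * b = \<gamma> / 4 * Q * v" by (simp add: b_def)
          moreover have "\<gamma> * Q * v = 4 * (\<gamma> / 4 * Q * v)" by simp
          ultimately have "\<gamma> / 2 * Q * v \<le> real (card (D xs)) * (M * Q)"
            using cnt big unfolding v_def by linarith
          then have "\<gamma> / (2 * M) * v \<le> real (card (D xs))"
            using Q Suc.prems by (simp add: field_simps)
          moreover have "\<delta> * v \<le> \<gamma> / (2 * M) * v"
            using v0 by (intro mult_right_mono) (auto simp: \<delta>_def)
          moreover have "D xs \<subseteq> (\<Union>j\<in>J. \<psi> j ` {..<Suc m})"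
          proof
            fix x assume "x \<in> D xs"
            then have "fresh_link \<psi> J m Q \<tau> (S xs) x \<noteq> {}" using b by (auto simp: D_def)
            then show "x \<in> (\<Union>j\<in>J. \<psi> j ` {..<Suc m})" by (auto simp: fresh_link_def)
          qed
          ultimately show ?thesis unfolding R v_def by linarith
        qed
      qed
      show "\<forall>I\<subseteq>V. indep_set \<psi> (Suc m) J I \<longrightarrow> (\<exists>R\<in>?\<R>. R \<inter> I = {})"
      proof (intro allI impI)
        fix I assume I: "I \<subseteq> V" "indep_set \<psi> (Suc m) J I"
        from exists_fingerprint[OF J b, of I \<psi> m Q \<tau>] obtain xs where
          xs: "set xs \<subseteq> I" "b * real (length xs) \<le> real (card (S xs))"
            "\<And>x. x \<in> I \<Longrightarrow> real (card (fresh_link \<psi> J m Q \<tau> (S xs) x)) < b"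
          unfolding S_def by blast
        have "real (card (S xs)) \<le> v * ((M + 1) * (Q * \<tau>))"
          unfolding v_def
        proof (rule card_le_spread[OF V finS])
          show "0 < m" by (simp add: m_def)
          show "\<psi> j 0 \<in> V" if "j \<in> S xs" for j using inV[of j 0] SJ that by auto
        qed (rule spS)
        then have "b * real (length xs) \<le> v * ((M + 1) * (Q * \<tau>))" using xs by linarith
        then have "Q * (\<gamma> * real (length xs)) \<le> Q * (4 * (M + 1) * \<tau> * v)"
          unfolding b_def by (simp add: algebra_simps)
        then have "\<gamma> * real (length xs) \<le> 4 * (M + 1) * \<tau> * v"
          using Q by (simp only: mult_le_cancel_left_pos)
        then have "real (length xs) \<le> 4 * (M + 1) / \<gamma> * \<tau> * v"
          using Suc.prems(2) by (simp add: pos_le_divide_eq mult.commute)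
        then have "length xs \<le> q" unfolding q_def by (rule le_nat_floor)
        then have X: "xs \<in> X" using xs I by (auto simp: X_def)
        have "\<exists>R\<in>\<R>' xs. R \<inter> I = {}"
        proof (cases "\<gamma>' * (Q * \<tau>) * v \<le> real (card (S xs))")
          case True
          \<comment> \<open>Coordinate \<open>m\<close> of a shadow hyperedge is an entry of
            \<open>xs\<close> and so lies in \<open>I\<close>; the coordinate outside
            \<open>I\<close> must be an earlier one.\<close>
          have "indep_set \<psi> m (S xs) I"
            unfolding indep_set_def
          proof
            fix j assume j: "j \<in> S xs"
            then have "j \<in> J" using SJ by blast
            then obtain a where a: "a < Suc m" "\<psi> j a \<notin> I" using I unfolding indep_set_def by blast
            have "\<psi> j m \<in> set xs" using j unfolding S_def by (rule shadow_coordinate)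
            then have "\<psi> j m \<in> I" using xs(1) by blast
            with a have "a < m" by (metis less_antisym)
            with a show "\<exists>a<m. \<psi> j a \<notin> I" by blast
          qed
          then show ?thesis using True \<R>'[of xs] I by (auto simp: deleting_family_def)
        next
          case False
          have "D xs \<inter> I = {}" using xs(3) unfolding D_def by force
          then show ?thesis using False \<R>'[of xs] by auto
        qed
        with X show "\<exists>R\<in>?\<R>. R \<inter> I = {}" by blast
      qed
    qed
    then show ?thesis unfolding v_def by blast
  qed
  with \<delta> K show ?case unfolding m_def by blast
qed

section \<open>Containers by iterated deletion\<close>

definition inner :: "('j \<Rightarrow> nat \<Rightarrow> 'v) \<Rightarrow> nat \<Rightarrow> 'j set \<Rightarrow> 'v set \<Rightarrow> 'j set" where
  "inner \<psi> r J C = {j \<in> J. \<forall>a<r. \<psi> j a \<in> C}"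

text \<open>While a container holds too many hyperedges, the hypergraph inside it has a deleting
  family, each member of which removes a proportion \<delta> of all of \<open>V\<close>. This
  happens a bounded number of times, so the exponent of the count grows only by a constant
  factor.\<close>

theorem containers:
  assumes M: "M > 0" and \<eta>: "\<eta> > 0"
  shows "\<exists>K\<ge>0. \<forall>V J Q \<tau>. spread_hypergraph \<psi> (Suc s) V J M Q \<tau> \<longrightarrow>
     (\<exists>\<C>. finite \<C> \<and> real (card \<C>) \<le> real (card V + 1) powr (K * \<tau> * real (card V)) \<and>
        (\<forall>C\<in>\<C>. C \<subseteq> V \<and> real (card (inner \<psi> (Suc s) J C)) \<le> \<eta> * Q * real (card V)) \<and>
        (\<forall>I\<subseteq>V. indep_set \<psi> (Suc s) J I \<longrightarrow> (\<exists>C\<in>\<C>. I \<subseteq> C)))"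
proof -
  define r where "r = Suc s"
  from deleting_family_exists[OF M \<eta>, of \<psi> s] obtain \<delta> K where \<delta>: "\<delta> > 0" and K: "K \<ge> 0" and
    step: "\<And>V J Q \<tau>. spread_hypergraph \<psi> r V J M Q \<tau> \<Longrightarrow> \<eta> * Q * real (card V) \<le> real (card J) \<Longrightarrow>
     \<exists>\<R>. deleting_family \<psi> r V J \<delta> (real (card V + 1) powr (K * \<tau> * real (card V))) \<R>"
    unfolding r_def by blast
  \<comment> \<open>With \<open>m * \<delta> > 1\<close>, a container still dense after
    \<open>m\<close> rounds would have negative size.\<close>
  define m where "m = Suc (nat \<lceil>1 / \<delta>\<rceil>)"
  have m: "real m * \<delta> > 1"
  proof -
    have "real m > 1 / \<delta>" unfolding m_def by linarith
    then show ?thesis using \<delta> by (simp add: field_simps)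
  qed
  have "\<exists>\<C>. finite \<C> \<and> real (card \<C>) \<le> real (card V + 1) powr (real m * K * \<tau> * real (card V)) \<and>
        (\<forall>C\<in>\<C>. C \<subseteq> V \<and> real (card (inner \<psi> r J C)) \<le> \<eta> * Q * real (card V)) \<and>
        (\<forall>I\<subseteq>V. indep_set \<psi> r J I \<longrightarrow> (\<exists>C\<in>\<C>. I \<subseteq> C))"
    if H: "spread_hypergraph \<psi> r V J M Q \<tau>" for V J Q \<tau>
  proof -
    have V: "finite V" and J: "finite J" and inV: "\<And>j a. j \<in> J \<Longrightarrow> a < r \<Longrightarrow> \<psi> j a \<in> V"
      and Q: "0 < Q" and \<tau>: "0 < \<tau>" "\<tau> \<le> 1" and sp: "spread \<psi> r J M Q \<tau>"
      using H by (auto simp: spread_hypergraph_def)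
    define v where "v = real (card V)"
    define B where "B = real (card V + 1) powr (K * \<tau> * v)"
    have B1: "B \<ge> 1" unfolding B_def v_def using K \<tau> by (intro ge_one_powr_ge_zero) auto
    let ?small = "\<lambda>C. real (card (inner \<psi> r J C)) \<le> \<eta> * Q * v"
    have "\<exists>\<C>. finite \<C> \<and> real (card \<C>) \<le> B ^ l \<and>
        (\<forall>C\<in>\<C>. C \<subseteq> V \<and> (?small C \<or> real (card C) \<le> v - real l * (\<delta> * v))) \<and>
        (\<forall>I\<subseteq>V. indep_set \<psi> r J I \<longrightarrow> (\<exists>C\<in>\<C>. I \<subseteq> C))" for l
    proof (induction l)
      case 0
      show ?case by (intro exI[of _ "{V}"]) (auto simp: v_def)
    next
      case (Suc l)
      then obtain \<C> where \<C>: "finite \<C>" "real (card \<C>) \<le> B ^ l"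
        "\<forall>C\<in>\<C>. C \<subseteq> V \<and> (?small C \<or> real (card C) \<le> v - real l * (\<delta> * v))"
        "\<forall>I\<subseteq>V. indep_set \<psi> r J I \<longrightarrow> (\<exists>C\<in>\<C>. I \<subseteq> C)"
        by (elim exE conjE)
      \<comment> \<open>For a container that is already sparse, \<open>{{}}\<close> leaves it
        unchanged.\<close>
      have "\<exists>\<R>. finite \<R> \<and> real (card \<R>) \<le> B \<and>
          (if ?small C then \<R> = {{}} else deleting_family \<psi> r V (inner \<psi> r J C) \<delta> B \<R>)" for C
      proof (cases "?small C")
        case True
        then show ?thesis using B1 by auto
      next
        case False
        have "spread_hypergraph \<psi> r V (inner \<psi> r J C) M Q \<tau>"
          using H spread_mono[OF sp _ J, of "inner \<psi> r J C"] unfolding spread_hypergraph_def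
          by (auto simp: inner_def)
        from step[OF this] False have "\<exists>\<R>. deleting_family \<psi> r V (inner \<psi> r J C) \<delta> B \<R>"
          by (simp add: v_def B_def)
        then show ?thesis using False by (auto simp: deleting_family_def)
      qed
      then obtain \<R> where fin\<R>: "\<And>C. finite (\<R> C)" and card\<R>: "\<And>C. real (card (\<R> C)) \<le> B"
        and \<R>: "\<And>C. if ?small C then \<R> C = {{}} else deleting_family \<psi> r V (inner \<psi> r J C) \<delta> B (\<R> C)"
        by metis
      let ?\<C> = "\<Union>C\<in>\<C>. (\<lambda>R. C - R) ` \<R> C"
      have "finite ?\<C>" using \<C> fin\<R> by blast
      moreover have "real (card ?\<C>) \<le> B ^ Suc l"
      proof -
        have "real (card ?\<C>) \<le> real (card \<C>) * B"
        proof (rule card_UN_le_real[OF \<C>(1)])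
          fix C
          have "card ((\<lambda>R. C - R) ` \<R> C) \<le> card (\<R> C)" by (rule card_image_le[OF fin\<R>])
          with card\<R>[of C] show "real (card ((\<lambda>R. C - R) ` \<R> C)) \<le> B" by linarith
        qed
        also have "\<dots> \<le> B ^ l * B" using \<C>(2) B1 by (intro mult_right_mono) auto
        finally show ?thesis by (simp add: mult.commute)
      qed
      moreover have "C' \<subseteq> V \<and> (?small C' \<or> real (card C') \<le> v - real (Suc l) * (\<delta> * v))"
        if C': "C' \<in> ?\<C>" for C'
      proof -
        from C' obtain C R where C: "C \<in> \<C>" "R \<in> \<R> C" "C' = C - R" by blast
        show ?thesis
        proof (cases "?small C")
          case True
          then show ?thesis using C \<R>[of C] \<C>(3) by auto
        next
          case False
          have R: "\<delta> * v \<le> real (card R)" "R \<subseteq> (\<Union>j\<in>inner \<psi> r J C. \<psi> j ` {..<r})"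
            using False C \<R>[of C] by (auto simp: deleting_family_def v_def)
          then have RC: "R \<subseteq> C" by (auto simp: inner_def)
          have CV: "C \<subseteq> V" and "real (card C) \<le> v - real l * (\<delta> * v)"
            using bspec[OF \<C>(3) C(1)] False by auto
          moreover have "card (C - R) = card C - card R" "card R \<le> card C"
            using RC CV V finite_subset by (metis card_Diff_subset, metis card_mono finite_subset)
          ultimately have "real (card C') \<le> v - real l * (\<delta> * v) - \<delta> * v" using C R by simp
          then show ?thesis using CV C by (auto simp: algebra_simps)
        qed
      qed
      moreover have "\<exists>C'\<in>?\<C>. I \<subseteq> C'" if I: "I \<subseteq> V" "indep_set \<psi> r J I" for I
      proof -
        from \<C>(4) I obtain C where C: "C \<in> \<C>" "I \<subseteq> C" by blast
        have "\<exists>R\<in>\<R> C. R \<inter> I = {}"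
        proof (cases "?small C")
          case True
          then show ?thesis using \<R>[of C] by auto
        next
          case False
          have "indep_set \<psi> r (inner \<psi> r J C) I" using I by (auto simp: indep_set_def inner_def)
          then show ?thesis using False \<R>[of C] I by (auto simp: deleting_family_def)
        qed
        then obtain R where R: "R \<in> \<R> C" "R \<inter> I = {}" by blast
        then have "C - R \<in> ?\<C>" using C(1) by blast
        moreover have "I \<subseteq> C - R" using C(2) R(2) by blast
        ultimately show ?thesis by (rule bexI[rotated])
      qed
      ultimately show ?case by (intro exI[of _ ?\<C>] conjI ballI allI impI) simp_all
    qed
    from this[of m] obtain \<C> where \<C>: "finite \<C>" "real (card \<C>) \<le> B ^ m"
        "\<forall>C\<in>\<C>. C \<subseteq> V \<and> (?small C \<or> real (card C) \<le> v - real m * (\<delta> * v))"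
        "\<forall>I\<subseteq>V. indep_set \<psi> r J I \<longrightarrow> (\<exists>C\<in>\<C>. I \<subseteq> C)"
        by (elim exE conjE)
    have "?small C" if C: "C \<in> \<C>" for C
    proof (rule ccontr)
      assume neg: "\<not> ?small C"
      then have le: "real (card C) \<le> v - real m * (\<delta> * v)" using \<C>(3) C by blast
      \<comment> \<open>If \<open>V\<close> is empty, there is no value for coordinate 0, hence no
        hyperedge, and the container is sparse after all.\<close>
      have "v > 0"
      proof (rule ccontr)
        assume "\<not> v > 0"
        then have "V = {}" using V by (auto simp: v_def)
        then have "J = {}" using inV[of _ 0] by (auto simp: r_def)
        then show False using neg Q \<eta> by (simp add: inner_def v_def)
      qed
      then have "v * (real m * \<delta>) > v * 1" using m by (intro mult_strict_left_mono)
      then show False using le by (simp add: algebra_simps)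
    qed
    moreover have "B ^ m = real (card V + 1) powr (real m * K * \<tau> * v)"
    proof -
      have "B ^ m = B powr real m" using B1 by (simp add: powr_realpow)
      also have "\<dots> = real (card V + 1) powr (real m * K * \<tau> * v)"
        unfolding B_def powr_powr by (simp add: mult_ac)
      finally show ?thesis .
    qed
    ultimately show ?thesis using \<C> unfolding v_def by (intro exI[of _ \<C>]) auto
  qed
  then show ?thesis using K unfolding r_def by (intro exI[of _ "real m * K"]) auto
qed

section \<open>Supersaturation\<close>

lemma finite_edges [simp]: "finite (edges n)"
  by (rule finite_subset[of _ "Pow {1..n}"]) (auto simp: edges_def)

lemma card_edges: "card (edges n) = n choose 2"
  using n_subsets[of "{1..n}" 2] by (simp add: edges_def)

lemma twice_choose_two_le: "2 * real (n choose 2) \<le> (real n)\<^sup>2"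
proof -
  have "2 * (n choose 2) \<le> n * (n - 1)" unfolding choose_two by (rule times_div_less_eq_dividend)
  also have "\<dots> \<le> n\<^sup>2" unfolding power2_eq_square by (intro mult_le_mono) auto
  finally have "real (2 * (n choose 2)) \<le> real (n\<^sup>2)" by (simp only: of_nat_le_iff)
  then show ?thesis by simp
qed

lemma finite_colourings: "finite (colourings k n)"
  unfolding colourings_def by (intro finite_PiE) auto

lemma finite_templates: "finite (templates k n)"
  unfolding templates_def by (intro finite_PiE) auto

lemma finite_embeddings: "finite (embeddings N n)"
  by (rule finite_subset[of _ "{1..N} \<rightarrow>\<^sub>E {1..n}"]) (auto simp: embeddings_def intro!: finite_PiE)

lemma log_card_bounds:
  assumes "S \<in> Pow {1..k} - {{}}"
  shows "0 \<le> log (real k) (real (card S))" "log (real k) (real (card S)) \<le> 1"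
proof -
  have S: "finite S" "S \<noteq> {}" "card S \<le> k"
    using assms finite_subset card_mono[of "{1..k}" S] by auto
  then have c: "card S \<ge> 1" by (simp add: Suc_leI card_gt_0_iff)
  show "0 \<le> log (real k) (real (card S))"
    using c S by (auto simp: log_def intro!: divide_nonneg_nonneg)
  show "log (real k) (real (card S)) \<le> 1"
    using c S by (auto simp: log_def divide_le_eq_1 intro!: ln_mono)
qed

lemma log_card_mono:
  assumes "S \<subseteq> S'" "S \<noteq> {}" "S' \<subseteq> {1..k}"
  shows "log (real k) (real (card S)) \<le> log (real k) (real (card S'))"
proof -
  have fin: "finite S'" using assms(3) finite_subset by blast
  have "card S \<le> card S'" "card S > 0" "card S' \<le> k"
    using assms fin finite_subset card_mono[of "{1..k}" S'] by (auto simp: card_mono card_gt_0_iff)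
  then show ?thesis by (auto simp: log_def intro!: divide_right_mono)
qed

lemma template_edge: "t \<in> templates k n \<Longrightarrow> e \<in> edges n \<Longrightarrow> t e \<in> Pow {1..k} - {{}}"
  by (auto simp: templates_def PiE_iff)

lemma Ent_bounds:
  assumes "t \<in> templates k n"
  shows "0 \<le> Ent k n t" "Ent k n t \<le> real (n choose 2)"
proof -
  show "0 \<le> Ent k n t"
    unfolding Ent_def using template_edge[OF assms] by (intro sum_nonneg log_card_bounds) auto
  have "Ent k n t \<le> (\<Sum>e\<in>edges n. 1)"
    unfolding Ent_def using template_edge[OF assms] by (intro sum_mono log_card_bounds) auto
  then show "Ent k n t \<le> real (n choose 2)" by (simp add: card_edges)
qed

lemma Ent_le_ex:
  assumes "t \<in> templates k n" "realisations k n t \<subseteq> P n"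
  shows "Ent k n t \<le> ex k n P"
proof -
  have "finite {Ent k n t | t. t \<in> templates k n \<and> realisations k n t \<subseteq> P n}"
    by (rule finite_subset[of _ "Ent k n ` templates k n"]) (auto simp: finite_templates)
  then show ?thesis unfolding ex_def using assms by (intro Max_ge) auto
qed

lemma ex_attained:
  assumes "c \<in> P n" "P n \<subseteq> colourings k n"
  obtains t where "t \<in> templates k n" "realisations k n t \<subseteq> P n" "Ent k n t = ex k n P"
proof -
  let ?X = "{Ent k n t | t. t \<in> templates k n \<and> realisations k n t \<subseteq> P n}"
  have "finite ?X"
    by (rule finite_subset[of _ "Ent k n ` templates k n"]) (auto simp: finite_templates)
  moreover have "?X \<noteq> {}"
  proof -
    \<comment> \<open>The singleton template of one colouring shows that the maximum is not taken
      over the empty set.\<close>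
    let ?t = "\<lambda>e\<in>edges n. {c e}"
    have c: "c \<in> colourings k n" using assms by blast
    then have "?t \<in> templates k n" by (auto simp: templates_def colourings_def)
    moreover have "realisations k n ?t \<subseteq> P n"
    proof
      fix d assume "d \<in> realisations k n ?t"
      then have "d = c"
        using c by (intro PiE_ext[of d "edges n" "\<lambda>_. {1..k}"])
          (auto simp: realisations_def colourings_def)
      then show "d \<in> P n" using assms by simp
    qed
    ultimately show ?thesis by blast
  qed
  ultimately have "ex k n P \<in> ?X" unfolding ex_def by (rule Max_in)
  then show ?thesis using that by auto
qed

lemma Forb_subset: "Forb k N F n \<subseteq> colourings k n"
  by (auto simp: Forb_def)

section \<open>Embeddings and pulled-back templates\<close>

lemma embedding_image_edge:
  assumes "\<phi> \<in> embeddings m n" "e \<in> edges m"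
  shows "\<phi> ` e \<in> edges n"
proof -
  have e: "e \<subseteq> {1..m}" "card e = 2" using assms by (auto simp: edges_def)
  have \<phi>: "\<phi> ` {1..m} \<subseteq> {1..n}" "inj_on \<phi> {1..m}" using assms by (auto simp: embeddings_def)
  have "card (\<phi> ` e) = 2" using card_image[OF inj_on_subset[OF \<phi>(2) e(1)]] e(2) by simp
  then show ?thesis using image_mono[OF e(1), of \<phi>] \<phi>(1) by (auto simp: edges_def)
qed

lemma embeddings_compose:
  assumes "\<phi> \<in> embeddings N m" "\<theta> \<in> embeddings m n"
  shows "restrict (\<theta> \<circ> \<phi>) {1..N} \<in> embeddings N n"
proof -
  have \<phi>: "\<phi> ` {1..N} \<subseteq> {1..m}" using assms by (auto simp: embeddings_def PiE_iff)
  have "inj_on (\<theta> \<circ> \<phi>) {1..N}"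
    using assms \<phi> by (intro comp_inj_on) (auto simp: embeddings_def intro: inj_on_subset)
  moreover have "mono_on {1..N} (\<theta> \<circ> \<phi>)"
    using assms \<phi> by (auto simp: embeddings_def mono_on_def image_subset_iff)
  moreover have "restrict (\<theta> \<circ> \<phi>) {1..N} \<in> {1..N} \<rightarrow>\<^sub>E {1..n}"
    using assms \<phi> by (auto simp: embeddings_def PiE_iff image_subset_iff)
  ultimately show ?thesis
    unfolding embeddings_def mem_Collect_eq inj_on_restrict_eq by (simp add: mono_on_def)
qed

lemma embedding_onto:
  assumes "S \<subseteq> {1..n}" "card S = m"
  shows "\<exists>\<theta>\<in>embeddings m n. \<theta> ` {1..m} = S"
proof -
  have "finite S" using assms finite_subset by blast
  then obtain h where h: "bij_betw h {..<m} S" "strict_mono_on {..<m} h"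
    using ex_bij_betw_strict_mono_card[of S] assms by metis
  \<comment> \<open>\<open>h\<close> enumerates \<open>S\<close> from 0, whereas vertices are
    numbered from 1.\<close>
  let ?\<theta> = "\<lambda>x\<in>{1..m}. h (x - 1)"
  have bij: "bij_betw (\<lambda>x. x - 1) {1..m} {..<m}"
    by (rule bij_betw_byWitness[where f' = Suc]) auto
  have "bij_betw (h \<circ> (\<lambda>x. x - 1)) {1..m} S" using bij h(1) by (rule bij_betw_trans)
  then have b: "bij_betw ?\<theta> {1..m} S" by (rule bij_betw_cong[THEN iffD1, rotated]) auto
  then have im: "?\<theta> ` {1..m} = S" by (rule bij_betw_imp_surj_on)
  have "mono_on {1..m} ?\<theta>"
  proof (rule mono_onI)
    fix x y assume "x \<in> {1..m}" "y \<in> {1..m}" "x \<le> y"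
    then show "?\<theta> x \<le> ?\<theta> y"
      using strict_mono_on_leD[OF h(2), of "x - 1" "y - 1"] by auto
  qed
  moreover have "?\<theta> \<in> {1..m} \<rightarrow>\<^sub>E {1..n}" using im assms by (auto simp: PiE_iff)
  ultimately have "?\<theta> \<in> embeddings m n"
    using b unfolding embeddings_def by (auto simp: bij_betw_def)
  with im show ?thesis by blast
qed

definition pull_template :: "nat \<Rightarrow> (nat set \<Rightarrow> nat set) \<Rightarrow> (nat \<Rightarrow> nat) \<Rightarrow> nat set \<Rightarrow> nat set" where
  "pull_template m t \<theta> = (\<lambda>e\<in>edges m. t (\<theta> ` e))"

lemma pull_template_in:
  assumes "t \<in> templates k n" "\<theta> \<in> embeddings m n"
  shows "pull_template m t \<theta> \<in> templates k m"
  unfolding pull_template_def templates_def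
  by (intro restrict_PiE_iff[THEN iffD2] ballI template_edge[OF assms(1)] embedding_image_edge[OF assms(2)])

lemma Ent_pull_template:
  assumes \<theta>: "\<theta> \<in> embeddings m n" and S: "\<theta> ` {1..m} = S"
  shows "Ent k m (pull_template m t \<theta>) = (\<Sum>e | e \<in> edges n \<and> e \<subseteq> S. log (real k) (real (card (t e))))"
proof -
  have inj: "inj_on \<theta> {1..m}" using \<theta> by (auto simp: embeddings_def)
  have im: "(`) \<theta> ` edges m = {e. e \<in> edges n \<and> e \<subseteq> S}"
  proof
    show "(`) \<theta> ` edges m \<subseteq> {e. e \<in> edges n \<and> e \<subseteq> S}"
      using embedding_image_edge[OF \<theta>] S by (auto simp: edges_def)
    show "{e. e \<in> edges n \<and> e \<subseteq> S} \<subseteq> (`) \<theta> ` edges m"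
    proof
      fix e assume "e \<in> {e. e \<in> edges n \<and> e \<subseteq> S}"
      then have e: "card e = 2" "e \<subseteq> \<theta> ` {1..m}" using S by (auto simp: edges_def)
      then obtain e' where e': "e' \<subseteq> {1..m}" "e = \<theta> ` e'" by (meson subset_imageE)
      then have "card e' = 2" using e inj by (metis card_image inj_on_subset)
      then show "e \<in> (`) \<theta> ` edges m" using e' by (auto simp: edges_def)
    qed
  qed
  have inj': "inj_on ((`) \<theta>) (edges m)"
    by (rule inj_on_subset[OF inj_on_image_Pow[OF inj]]) (auto simp: edges_def)
  have "Ent k m (pull_template m t \<theta>) = (\<Sum>e\<in>edges m. log (real k) (real (card (t (\<theta> ` e)))))"
    unfolding Ent_def pull_template_def by (intro sum.cong) auto
  also have "\<dots> = (\<Sum>e\<in>(`) \<theta> ` edges m. log (real k) (real (card (t e))))"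
    by (subst sum.reindex[OF inj']) auto
  finally show ?thesis unfolding im by simp
qed

section \<open>Averaging over vertex subsets\<close>

lemma card_intermediate_sets:
  assumes "finite X" "T \<subseteq> X" "card T \<le> m"
  shows "card {S. S \<subseteq> X \<and> card S = m \<and> T \<subseteq> S} = (card X - card T) choose (m - card T)"
proof -
  have fT: "finite T" using assms finite_subset by blast
  have "bij_betw (\<lambda>S. S - T) {S. S \<subseteq> X \<and> card S = m \<and> T \<subseteq> S} {B. B \<subseteq> X - T \<and> card B = m - card T}"
  proof (rule bij_betw_byWitness[where f' = "\<lambda>B. B \<union> T"])
    show "(\<lambda>S. S - T) ` {S. S \<subseteq> X \<and> card S = m \<and> T \<subseteq> S} \<subseteq> {B. B \<subseteq> X - T \<and> card B = m - card T}"
      using fT by (auto simp: card_Diff_subset)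
    show "(\<lambda>B. B \<union> T) ` {B. B \<subseteq> X - T \<and> card B = m - card T} \<subseteq> {S. S \<subseteq> X \<and> card S = m \<and> T \<subseteq> S}"
    proof clarify
      fix B assume B: "B \<subseteq> X - T" "card B = m - card T"
      have "finite B" using B assms finite_subset by blast
      then have "card (B \<union> T) = card B + card T" using B fT by (intro card_Un_disjoint) auto
      then show "B \<union> T \<subseteq> X \<and> card (B \<union> T) = m \<and> T \<subseteq> B \<union> T" using B assms by auto
    qed
  qed auto
  then have "card {S. S \<subseteq> X \<and> card S = m \<and> T \<subseteq> S} = card {B. B \<subseteq> X - T \<and> card B = m - card T}"
    by (rule bij_betw_same_card)
  also have "\<dots> = card (X - T) choose (m - card T)" using assms by (intro n_subsets) auto
  finally show ?thesis using assms fT by (simp add: card_Diff_subset)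
qed

lemma sum_over_subsets_edges:
  assumes "2 \<le> m"
  shows "(\<Sum>S | S \<subseteq> {1..n} \<and> card S = m. \<Sum>e | e \<in> edges n \<and> e \<subseteq> S. f e)
    = real ((n - 2) choose (m - 2)) * (\<Sum>e\<in>edges n. f e)"
proof -
  let ?X = "{S. S \<subseteq> {1..n} \<and> card S = m}"
  have fin: "finite ?X" by (rule finite_subset[of _ "Pow {1..n}"]) auto
  have "(\<Sum>S\<in>?X. \<Sum>e | e \<in> edges n \<and> e \<subseteq> S. f e) = (\<Sum>e\<in>edges n. \<Sum>S | S \<in> ?X \<and> e \<subseteq> S. f e)"
    using sum.swap_restrict[OF fin finite_edges[of n], of "\<lambda>S e. f e" "\<lambda>S e. e \<subseteq> S"] by simp
  also have "\<dots> = (\<Sum>e\<in>edges n. real ((n - 2) choose (m - 2)) * f e)"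
  proof (rule sum.cong[OF refl])
    fix e assume "e \<in> edges n"
    then have e: "e \<subseteq> {1..n}" "card e = 2" by (auto simp: edges_def)
    have "{S. S \<in> ?X \<and> e \<subseteq> S} = {S. S \<subseteq> {1..n} \<and> card S = m \<and> e \<subseteq> S}" by auto
    then have "card {S. S \<in> ?X \<and> e \<subseteq> S} = (n - 2) choose (m - 2)"
      using card_intermediate_sets[of "{1..n}" e m] e assms by simp
    then show "(\<Sum>S | S \<in> ?X \<and> e \<subseteq> S. f e) = real ((n - 2) choose (m - 2)) * f e" by simp
  qed
  finally show ?thesis by (simp add: sum_distrib_left)
qed

text \<open>These are the hyperedges of the copy hypergraph all of whose vertices lie in
  \<open>t\<close>; different forbidden colourings on one embedding count separately, as they do
  there.\<close>

definition bad_pairs ::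
  "nat \<Rightarrow> (nat set \<Rightarrow> nat) set \<Rightarrow> nat \<Rightarrow> (nat set \<Rightarrow> nat set) \<Rightarrow> ((nat \<Rightarrow> nat) \<times> (nat set \<Rightarrow> nat)) set" where
  "bad_pairs N F n t = {(\<phi>, c). \<phi> \<in> embeddings N n \<and> c \<in> F \<and> (\<forall>e\<in>edges N. c e \<in> t (\<phi> ` e))}"

lemma finite_bad_pairs: "finite F \<Longrightarrow> finite (bad_pairs N F n t)"
  by (rule finite_subset[of _ "embeddings N n \<times> F"]) (auto simp: bad_pairs_def finite_embeddings)

text \<open>Entropy above the extremal value forces a realisation of the pulled-back template
  outside the property; the copy witnessing this is carried along \<theta>, and its colours are
  available in \<open>t\<close>.\<close>

lemma bad_pair_in_subset:
  assumes t: "t \<in> templates k n" and \<theta>: "\<theta> \<in> embeddings m n"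
    and big: "ex k m (Forb k N F) < Ent k m (pull_template m t \<theta>)"
  shows "\<exists>(\<phi>, c)\<in>bad_pairs N F n t. \<phi> ` {1..N} \<subseteq> \<theta> ` {1..m}"
proof -
  have "\<not> realisations k m (pull_template m t \<theta>) \<subseteq> Forb k N F m"
    using Ent_le_ex[OF pull_template_in[OF t \<theta>], of "Forb k N F"] big by auto
  then obtain d where d: "d \<in> realisations k m (pull_template m t \<theta>)" "d \<notin> Forb k N F m" by blast
  then obtain \<phi> where \<phi>: "\<phi> \<in> embeddings N m" "pullback N d \<phi> \<in> F"
    by (auto simp: Forb_def realisations_def)
  let ?\<phi> = "restrict (\<theta> \<circ> \<phi>) {1..N}"
  have "pullback N d \<phi> e \<in> t (?\<phi> ` e)" if e: "e \<in> edges N" for e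
  proof -
    have "\<phi> ` e \<in> edges m" by (rule embedding_image_edge[OF \<phi>(1) e])
    then have "d (\<phi> ` e) \<in> t (\<theta> ` \<phi> ` e)"
      using d(1) by (auto simp: realisations_def pull_template_def)
    moreover have "?\<phi> ` e = \<theta> ` \<phi> ` e" using e by (auto simp: edges_def subset_iff)
    ultimately show ?thesis using e by (simp add: pullback_def)
  qed
  then have "(?\<phi>, pullback N d \<phi>) \<in> bad_pairs N F n t"
    using embeddings_compose[OF \<phi>(1) \<theta>] \<phi>(2) by (simp add: bad_pairs_def)
  moreover have "?\<phi> ` {1..N} \<subseteq> \<theta> ` {1..m}"
    using \<phi>(1) by (auto simp: embeddings_def PiE_iff)
  ultimately show ?thesis by blast
qed

text \<open>No convergence of the densities \<open>d m\<close> is required: with their infimum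
  \<pi>, one \<open>m\<close> with \<open>d m < \<pi> + \<epsilon>\<close> suffices, as
  \<open>\<pi> \<le> d n\<close> for all \<open>n \<ge> N\<close>. A template of large entropy has
  average density at least \<open>\<pi> + 2 * \<epsilon>\<close> on the \<open>m\<close>-sets, so a
  proportion \<epsilon> of these exceed the extremal entropy and hold a forbidden copy.\<close>

theorem supersaturation:
  assumes N: "N \<ge> 2" and F: "finite F" and ne: "\<And>n. Forb k N F n \<noteq> {}" and \<epsilon>: "\<epsilon> > 0"
  shows "\<exists>\<eta>>0. \<exists>n0. \<forall>n\<ge>n0. \<forall>t\<in>templates k n.
    ex k n (Forb k N F) + \<epsilon> * (real n)\<^sup>2 < Ent k n t \<longrightarrow> \<eta> * real n ^ N \<le> real (card (bad_pairs N F n t))"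
proof -
  define P where "P = Forb k N F"
  define d where "d m = ex k m P / real (m choose 2)" for m
  have ex0: "ex k m P \<ge> 0" for m
  proof -
    obtain c where "c \<in> P m" using ne[of m] by (auto simp: P_def)
    then obtain t where "t \<in> templates k m" "Ent k m t = ex k m P"
      using ex_attained[of c P m k] Forb_subset unfolding P_def by metis
    then show ?thesis using Ent_bounds(1) by metis
  qed
  have bdd: "bdd_below (d ` {N..})" by (rule bdd_belowI[of _ 0]) (auto simp: d_def ex0)
  define \<pi> where "\<pi> = Inf (d ` {N..})"
  have \<pi>: "\<pi> \<le> d n" if "n \<ge> N" for n
    unfolding \<pi>_def using that by (intro cInf_lower bdd) auto
  have "\<exists>x\<in>d ` {N..}. x < \<pi> + \<epsilon>"
    unfolding \<pi>_def using \<epsilon> by (intro cInf_lessD) auto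
  then obtain m where m: "m \<ge> N" "d m < \<pi> + \<epsilon>" by auto
  have m2: "real (m choose 2) > 0" using m N by simp
  have mN: "real (m choose N) > 0" using m by simp
  \<comment> \<open>Each bad pair serves \<open>(n - N) choose (m - N)\<close> of the
    \<open>\<epsilon> * (n choose m)\<close> good sets, which leaves at least
    \<open>\<epsilon> * (n choose N) / (m choose N)\<close> bad pairs, and \<open>n choose N\<close>
    is at least \<open>(n / N) ^ N\<close>.\<close>
  define \<eta> where "\<eta> = \<epsilon> / (real N ^ N * real (m choose N))"
  have \<eta>: "\<eta> > 0" using \<epsilon> mN N by (simp add: \<eta>_def)
  have "\<eta> * real n ^ N \<le> real (card (bad_pairs N F n t))"
    if n: "n \<ge> m" and t: "t \<in> templates k n" and big: "ex k n P + \<epsilon> * (real n)\<^sup>2 < Ent k n t" for n t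
  proof -
    let ?X = "{S. S \<subseteq> {1..n} \<and> card S = m}"
    let ?bad = "bad_pairs N F n t"
    have fX: "finite ?X" by (rule finite_subset[of _ "Pow {1..n}"]) auto
    have cX: "card ?X = n choose m" using n_subsets[of "{1..n}" m] by simp
    have "\<forall>S\<in>?X. \<exists>\<theta>. \<theta> \<in> embeddings m n \<and> \<theta> ` {1..m} = S"
      using embedding_onto by blast
    from bchoice[OF this] obtain \<theta> where
      \<theta>': "\<forall>S\<in>?X. \<theta> S \<in> embeddings m n \<and> \<theta> S ` {1..m} = S" by (elim exE)
    have \<theta>: "\<theta> S \<in> embeddings m n" "\<theta> S ` {1..m} = S" if "S \<in> ?X" for S
      using bspec[OF \<theta>' that] by blast+
    define E where "E S = Ent k m (pull_template m t (\<theta> S))" for S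
    define good where "good = {S \<in> ?X. ex k m P < E S}"
    have n2: "real (n choose 2) > 0" using n m N by simp
    have "(\<Sum>S\<in>?X. E S) = (\<Sum>S\<in>?X. \<Sum>e | e \<in> edges n \<and> e \<subseteq> S. log (real k) (real (card (t e))))"
      unfolding E_def using \<theta> by (intro sum.cong refl Ent_pull_template)
    also have "\<dots> = real ((n - 2) choose (m - 2)) * Ent k n t"
      using m N unfolding Ent_def by (intro sum_over_subsets_edges) simp
    finally have sumE: "(\<Sum>S\<in>?X. E S) = real ((n - 2) choose (m - 2)) * Ent k n t" .
    have "(n choose m) * (m choose 2) = (n choose 2) * ((n - 2) choose (m - 2))"
      using m N n by (intro choose_mult) auto
    then have id2: "real (n choose m) * real (m choose 2) = real (n choose 2) * real ((n - 2) choose (m - 2))"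
      by (simp only: flip: of_nat_mult)
    have "(n choose m) * (m choose N) = (n choose N) * ((n - N) choose (m - N))"
      using m n by (intro choose_mult) auto
    then have idN: "real (n choose m) * real (m choose N) = real (n choose N) * real ((n - N) choose (m - N))"
      by (simp only: flip: of_nat_mult)
    \<comment> \<open>The surplus \<open>\<epsilon> * (real n)\<^sup>2\<close> is worth
      \<open>2 * \<epsilon>\<close> in density; half of it absorbs the error in the choice of
      \<open>m\<close>.\<close>
    have "\<epsilon> * (2 * real (n choose 2)) \<le> \<epsilon> * (real n)\<^sup>2"
      using \<epsilon> by (intro mult_left_mono twice_choose_two_le) simp
    moreover have "\<pi> * real (n choose 2) \<le> ex k n P"
      using \<pi>[of n] n m n2 by (simp add: d_def field_simps)
    moreover have "(\<pi> + 2 * \<epsilon>) * real (n choose 2) = \<pi> * real (n choose 2) + \<epsilon> * (2 * real (n choose 2))"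
      by (simp add: algebra_simps)
    ultimately have "(\<pi> + 2 * \<epsilon>) * real (n choose 2) \<le> ex k n P + \<epsilon> * (real n)\<^sup>2"
      by linarith
    then have lb: "(\<pi> + 2 * \<epsilon>) * real (n choose 2) \<le> Ent k n t" using big by linarith
    have "real (n choose m) * (real (m choose 2) * (\<pi> + 2 * \<epsilon>))
        = real ((n - 2) choose (m - 2)) * ((\<pi> + 2 * \<epsilon>) * real (n choose 2))"
      using id2 by (simp add: algebra_simps)
    also have "\<dots> \<le> (\<Sum>S\<in>?X. E S)"
      unfolding sumE using lb by (intro mult_left_mono) auto
    also have "\<dots> \<le> (\<Sum>S\<in>?X. ex k m P + (if S \<in> good then real (m choose 2) else 0))"
    proof (rule sum_mono)
      fix S assume S: "S \<in> ?X"
      have "E S \<le> real (m choose 2)"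
        unfolding E_def by (rule Ent_bounds(2)[OF pull_template_in[OF t \<theta>(1)[OF S]]])
      then show "E S \<le> ex k m P + (if S \<in> good then real (m choose 2) else 0)"
        using ex0[of m] S by (auto simp: good_def)
    qed
    also have "\<dots> = real (n choose m) * ex k m P + real (card good) * real (m choose 2)"
    proof -
      have "?X \<inter> good = good" by (auto simp: good_def)
      then show ?thesis using fX cX by (simp add: sum.distrib sum.If_cases)
    qed
    also have "\<dots> \<le> real (n choose m) * (real (m choose 2) * (\<pi> + \<epsilon>)) + real (card good) * real (m choose 2)"
      using m(2) m2 by (intro add_right_mono mult_left_mono) (auto simp: d_def field_simps)
    finally have "real (m choose 2) * (\<epsilon> * real (n choose m)) \<le> real (m choose 2) * real (card good)"
      by (simp add: algebra_simps)
    then have good1: "\<epsilon> * real (n choose m) \<le> real (card good)" using m2 by (simp only: mult_le_cancel_left_pos)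
    have "good \<subseteq> (\<Union>x\<in>?bad. {S. S \<subseteq> {1..n} \<and> card S = m \<and> fst x ` {1..N} \<subseteq> S})"
    proof
      fix S assume S: "S \<in> good"
      then have SX: "S \<in> ?X" by (simp add: good_def)
      from bad_pair_in_subset[OF t \<theta>(1)[OF SX], of N F] S obtain x
        where "x \<in> ?bad" "fst x ` {1..N} \<subseteq> \<theta> S ` {1..m}"
        by (auto simp: good_def E_def P_def)
      then show "S \<in> (\<Union>x\<in>?bad. {S. S \<subseteq> {1..n} \<and> card S = m \<and> fst x ` {1..N} \<subseteq> S})"
        using \<theta>(2)[OF SX] SX by auto
    qed
    then have "card good \<le> card (\<Union>x\<in>?bad. {S. S \<subseteq> {1..n} \<and> card S = m \<and> fst x ` {1..N} \<subseteq> S})"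
      by (rule card_mono[rotated]) (auto intro!: finite_bad_pairs F finite_subset[of _ "Pow {1..n}"])
    also have "\<dots> \<le> (\<Sum>x\<in>?bad. card {S. S \<subseteq> {1..n} \<and> card S = m \<and> fst x ` {1..N} \<subseteq> S})"
      by (rule card_UN_le[OF finite_bad_pairs[OF F]])
    also have "\<dots> = (\<Sum>x\<in>?bad. (n - N) choose (m - N))"
    proof (rule sum.cong[OF refl])
      fix x assume "x \<in> ?bad"
      then have x: "fst x \<in> embeddings N n" by (auto simp: bad_pairs_def)
      then have "card (fst x ` {1..N}) = N" "fst x ` {1..N} \<subseteq> {1..n}"
        by (auto simp: embeddings_def card_image)
      then show "card {S. S \<subseteq> {1..n} \<and> card S = m \<and> fst x ` {1..N} \<subseteq> S} = (n - N) choose (m - N)"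
        using card_intermediate_sets[of "{1..n}" "fst x ` {1..N}" m] m by simp
    qed
    finally have "card good \<le> card ?bad * ((n - N) choose (m - N))" by simp
    then have "real (card good) \<le> real (card ?bad) * real ((n - N) choose (m - N))"
      by (simp only: of_nat_le_iff flip: of_nat_mult)
    with good1 have "\<epsilon> * real (n choose m) * real (m choose N)
        \<le> real (card ?bad) * real ((n - N) choose (m - N)) * real (m choose N)"
      by (intro mult_right_mono) auto
    also have "\<epsilon> * real (n choose m) * real (m choose N)
        = \<epsilon> * real (n choose N) * real ((n - N) choose (m - N))"
      using idN by (simp add: mult.assoc)
    finally have "real ((n - N) choose (m - N)) * (\<epsilon> * real (n choose N))
        \<le> real ((n - N) choose (m - N)) * (real (card ?bad) * real (m choose N))"
      by (simp add: mult_ac)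
    moreover have "real ((n - N) choose (m - N)) > 0" using n m by simp
    ultimately have fin: "\<epsilon> * real (n choose N) \<le> real (card ?bad) * real (m choose N)"
      by (simp only: mult_le_cancel_left_pos)
    have "(real n / real N) ^ N \<le> real (n choose N)"
      using n m by (intro binomial_ge_n_over_k_pow_k) simp
    then have "\<epsilon> * (real n / real N) ^ N \<le> real (card ?bad) * real (m choose N)"
      using fin \<epsilon> mult_left_mono[of "(real n / real N) ^ N" "real (n choose N)" \<epsilon>] by linarith
    then have "\<epsilon> * (real n / real N) ^ N / real (m choose N) \<le> real (card ?bad)"
      using mN by (simp add: pos_divide_le_eq)
    then show ?thesis unfolding \<eta>_def by (simp add: power_divide)
  qed
  with \<eta> show ?thesis unfolding P_def by (intro exI[of _ \<eta>] conjI exI[of _ m]) auto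
qed

section \<open>Containers for templates\<close>

lemma embedding_less:
  assumes "\<phi> \<in> embeddings N n" "x \<in> {1..N}" "y \<in> {1..N}" "x < y"
  shows "\<phi> x < \<phi> y"
proof -
  have "\<phi> x \<le> \<phi> y" using assms by (auto simp: embeddings_def mono_on_def)
  moreover have "\<phi> x \<noteq> \<phi> y" using assms by (auto simp: embeddings_def dest: inj_onD)
  ultimately show ?thesis by simp
qed

text \<open>Order preservation decides which endpoint goes where, so the image of an edge as a set
  already fixes the embedding on it.\<close>

lemma embeddings_agree_on_edge:
  assumes "\<phi> \<in> embeddings N n" "\<phi>' \<in> embeddings N n" "e \<in> edges N" "\<phi> ` e = \<phi>' ` e" "x \<in> e"
  shows "\<phi> x = \<phi>' x"
proof -
  obtain a b where ab: "e = {a, b}" "a < b" "a \<in> {1..N}" "b \<in> {1..N}"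
  proof -
    from assms(3) obtain a b where "e = {a, b}" "a \<noteq> b" "e \<subseteq> {1..N}"
      by (auto simp: edges_def card_2_iff)
    then show ?thesis using that[of a b] that[of b a] by (cases "a < b") auto
  qed
  have "\<phi> a < \<phi> b" "\<phi>' a < \<phi>' b"
    using ab assms embedding_less by blast+
  moreover have "{\<phi> a, \<phi> b} = {\<phi>' a, \<phi>' b}" using assms(4) ab by simp
  ultimately have "\<phi> a = \<phi>' a \<and> \<phi> b = \<phi>' b" by (auto simp: doubleton_eq_iff)
  then show ?thesis using assms(5) ab by auto
qed

lemma card_embeddings_prescribed:
  assumes X: "X \<subseteq> embeddings N n" and W: "W \<subseteq> {1..N}"
    and agree: "\<And>\<phi> \<phi>' x. \<phi> \<in> X \<Longrightarrow> \<phi>' \<in> X \<Longrightarrow> x \<in> W \<Longrightarrow> \<phi> x = \<phi>' x"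
  shows "card X \<le> n ^ (N - card W)"
proof -
  let ?f = "\<lambda>\<phi>. restrict \<phi> ({1..N} - W)"
  have "inj_on ?f X"
  proof (rule inj_onI)
    fix \<phi> \<phi>' assume \<phi>: "\<phi> \<in> X" "\<phi>' \<in> X" "?f \<phi> = ?f \<phi>'"
    show "\<phi> = \<phi>'"
    proof (rule extensionalityI[where A = "{1..N}"])
      show "\<phi> \<in> extensional {1..N}" "\<phi>' \<in> extensional {1..N}"
        using \<phi> X by (auto simp: embeddings_def PiE_iff)
      fix x assume x: "x \<in> {1..N}"
      show "\<phi> x = \<phi>' x"
      proof (cases "x \<in> W")
        case True
        then show ?thesis using agree \<phi> by blast
      next
        case False
        then show ?thesis using fun_cong[OF \<phi>(3), of x] x by simp
      qed
    qed
  qed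
  moreover have "?f ` X \<subseteq> ({1..N} - W) \<rightarrow>\<^sub>E {1..n}"
    using X by (auto simp: embeddings_def PiE_iff subset_iff)
  ultimately have "card X \<le> card (({1..N} - W) \<rightarrow>\<^sub>E {1..n})"
    by (intro card_inj_on_le[of ?f] finite_PiE) auto
  also have "\<dots> = n ^ card ({1..N} - W)" by (simp add: card_PiE)
  also have "card ({1..N} - W) = N - card W" using W finite_subset by (subst card_Diff_subset) auto
  finally show ?thesis .
qed

definition copy_vertex :: "(nat \<Rightarrow> nat set) \<Rightarrow> (nat \<Rightarrow> nat) \<times> (nat set \<Rightarrow> nat) \<Rightarrow> nat \<Rightarrow> nat set \<times> nat" where
  "copy_vertex E j a = (fst j ` E a, snd j (E a))"

text \<open>Prescribed pairs fix the embedding on the union \<open>W\<close> of their edges, leaving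
  at most \<open>n ^ (N - card W)\<close> embeddings and \<open>card F\<close> colourings. One pair
  gives \<open>card W \<ge> 2\<close>, two give \<open>card W \<ge> 3\<close>, and the resulting
  factor \<open>1 / n\<close> is at most \<open>\<tau> ^ (card A - 1)\<close> by the condition on
  \<sigma>. The \<open>+ 1\<close> keeps the constant positive when \<open>F\<close> is
  empty.\<close>

lemma spread_copies:
  assumes N: "N \<ge> 2" and F: "finite F" and n: "n \<ge> 1" and \<sigma>: "\<sigma> \<ge> 0" "\<sigma> * (real r - 1) \<le> 1"
    and E: "bij_betw E {..<r} (edges N)"
  shows "spread (copy_vertex E) r (embeddings N n \<times> F) (real (card F) + 1) (real n ^ (N - 2)) (real n powr (- \<sigma>))"
  unfolding spread_def
proof (intro allI impI)
  fix A :: "nat set" and u assume A: "A \<noteq> {} \<and> A \<subseteq> {..<r}"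
  define X where "X = fibre (copy_vertex E) (embeddings N n \<times> F) A u"
  define W where "W = (\<Union>a\<in>A. E a)"
  have Ee: "E a \<in> edges N" if "a \<in> A" for a using A E that by (auto simp: bij_betw_def)
  have finA: "finite A" using A finite_subset by blast
  have W: "W \<subseteq> {1..N}" using Ee by (fastforce simp: W_def edges_def)
  have finW: "finite W" using W finite_subset by blast
  have "card (fst ` X) \<le> n ^ (N - card W)"
  proof (rule card_embeddings_prescribed[OF _ W])
    show sub: "fst ` X \<subseteq> embeddings N n" by (auto simp: X_def fibre_def)
    fix \<phi> \<phi>' x assume \<phi>: "\<phi> \<in> fst ` X" "\<phi>' \<in> fst ` X" and "x \<in> W"
    then obtain a where a: "a \<in> A" "x \<in> E a" by (auto simp: W_def)
    have "\<phi>'' ` E a = fst (u a)" if \<phi>'': "\<phi>'' \<in> fst ` X" for \<phi>''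
    proof -
      from \<phi>'' obtain c where "(\<phi>'', c) \<in> X" by auto
      then have "u a = copy_vertex E (\<phi>'', c) a" using a by (simp add: X_def fibre_def)
      then show ?thesis by (simp add: copy_vertex_def)
    qed
    then show "\<phi> x = \<phi>' x"
      using \<phi> sub a Ee by (intro embeddings_agree_on_edge[of \<phi> N n \<phi>' "E a"]) auto
  qed
  moreover have "card X \<le> card (fst ` X \<times> F)"
  proof (rule card_mono)
    have "finite (fst ` X)"
      by (rule finite_subset[OF _ finite_embeddings[of N n]]) (auto simp: X_def fibre_def)
    then show "finite (fst ` X \<times> F)" using F by simp
    show "X \<subseteq> fst ` X \<times> F" by (force simp: X_def fibre_def)
  qed
  ultimately have cX: "card X \<le> n ^ (N - card W) * card F"
    by (metis card_cartesian_product le_trans mult_le_mono1)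
  have pow: "real n ^ (N - card W) \<le> real n ^ (N - 2) * (real n powr (- \<sigma>)) ^ (card A - 1)"
  proof (cases "card A \<le> 1")
    case True
    obtain a where a: "a \<in> A" using A by blast
    have "card (E a) \<le> card W" using a finW by (intro card_mono) (auto simp: W_def)
    then have "card W \<ge> 2" using Ee[OF a] by (simp add: edges_def)
    then have "real n ^ (N - card W) \<le> real n ^ (N - 2)" using n by (intro power_increasing) auto
    then show ?thesis using True by simp
  next
    case False
    then obtain a b where ab: "a \<in> A" "b \<in> A" "a \<noteq> b"
      using finA by (metis card_le_Suc0_iff_eq One_nat_def)
    have "inj_on E {..<r}" using E by (auto simp: bij_betw_def)
    then have ne: "E a \<noteq> E b" using ab A by (auto dest: inj_onD)
    have sub: "E a \<subseteq> W" "E b \<subseteq> W" using ab by (auto simp: W_def)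
    have c2: "card (E a) = 2" "card (E b) = 2" using Ee ab by (auto simp: edges_def)
    have "card W \<ge> 2" using card_mono[OF finW sub(1)] c2 by simp
    moreover have "card W \<noteq> 2"
      using card_subset_eq[OF finW sub(1)] card_subset_eq[OF finW sub(2)] c2 ne by auto
    ultimately have W3: "card W \<ge> 3" by simp
    have N3: "N \<ge> 3" using W3 card_mono[of "{1..N}" W] W by simp
    have cA: "real (card A) \<le> real r" using A card_mono[of "{..<r}" A] by simp
    have "real n ^ (N - card W) \<le> real n ^ (N - 3)" using n W3 by (intro power_increasing) auto
    also have "\<dots> = real n ^ (N - 2) * real n powr (- 1)"
    proof -
      have "N - 2 = Suc (N - 3)" using N3 by simp
      then show ?thesis using n by (simp add: powr_minus)
    qed
    also have "\<dots> \<le> real n ^ (N - 2) * (real n powr (- \<sigma>)) ^ (card A - 1)"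
    proof (intro mult_left_mono)
      have "(real n powr (- \<sigma>)) ^ (card A - 1) = real n powr (- \<sigma> * real (card A - 1))"
        using n by (simp add: powr_realpow[symmetric] powr_powr)
      moreover have "- 1 \<le> - \<sigma> * real (card A - 1)"
      proof -
        have "\<sigma> * real (card A - 1) \<le> \<sigma> * (real r - 1)"
          using \<sigma> cA False by (intro mult_left_mono) auto
        then show ?thesis using \<sigma> by simp
      qed
      ultimately show "real n powr (- 1) \<le> (real n powr (- \<sigma>)) ^ (card A - 1)"
        using powr_mono[of "- 1" "- \<sigma> * real (card A - 1)" "real n"] n by (simp only:)
    qed simp
    finally show ?thesis .
  qed
  have "real (card X) \<le> real (n ^ (N - card W) * card F)" using cX by (simp only: of_nat_le_iff)
  also have "\<dots> = real (card F) * real n ^ (N - card W)" by simp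
  also have "\<dots> \<le> (real (card F) + 1) * (real n ^ (N - 2) * (real n powr (- \<sigma>)) ^ (card A - 1))"
    using pow by (intro mult_mono) auto
  finally show "real (card (fibre (copy_vertex E) (embeddings N n \<times> F) A u))
      \<le> (real (card F) + 1) * real n ^ (N - 2) * (real n powr (- \<sigma>)) ^ (card A - 1)"
    by (simp add: X_def mult.assoc)
qed

text \<open>If every pair of a copy lay in \<open>t\<close>, colouring the copy as prescribed and
  the other edges by any colours of \<open>t\<close> would give a realisation whose pullback is the
  forbidden colouring.\<close>

lemma indep_set_template:
  assumes t: "t \<in> templates k n" and P: "realisations k n t \<subseteq> Forb k N F n"
    and F: "F \<subseteq> colourings k N" and E: "bij_betw E {..<r} (edges N)"
  shows "indep_set (copy_vertex E) r (embeddings N n \<times> F) {(e, x). e \<in> edges n \<and> x \<in> t e}"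
  unfolding indep_set_def
proof (rule ballI, rule ccontr)
  fix j assume j: "j \<in> embeddings N n \<times> F"
    and c: "\<not> (\<exists>a<r. copy_vertex E j a \<notin> {(e, x). e \<in> edges n \<and> x \<in> t e})"
  obtain \<phi> c where jeq: "j = (\<phi>, c)" by (cases j)
  have \<phi>: "\<phi> \<in> embeddings N n" and cF: "c \<in> F" using j jeq by auto
  have all: "c e \<in> t (\<phi> ` e)" if "e \<in> edges N" for e
  proof -
    have "e \<in> E ` {..<r}" using that E by (simp add: bij_betw_def)
    then obtain a where "a < r" "e = E a" by blast
    then show ?thesis using c jeq by (auto simp: copy_vertex_def)
  qed
  have inj: "inj_on ((`) \<phi>) (edges N)"
    using \<phi> by (intro inj_on_subset[OF inj_on_image_Pow[of \<phi> "{1..N}"]]) (auto simp: embeddings_def edges_def)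
  define d where "d = (\<lambda>e\<in>edges n. if e \<in> (`) \<phi> ` edges N then c (inv_into (edges N) ((`) \<phi>) e)
      else SOME x. x \<in> t e)"
  have dt: "d e \<in> t e" if e: "e \<in> edges n" for e
  proof (cases "e \<in> (`) \<phi> ` edges N")
    case True
    then obtain e' where "e' \<in> edges N" "e = \<phi> ` e'" by blast
    then show ?thesis using e all inj by (auto simp: d_def inv_into_f_f)
  next
    case False
    have "t e \<noteq> {}" using template_edge[OF t e] by blast
    then show ?thesis using False e by (simp add: d_def some_in_eq)
  qed
  have "d \<in> colourings k n"
    unfolding colourings_def
  proof
    show "d e \<in> {1..k}" if "e \<in> edges n" for e
      using dt[OF that] template_edge[OF t that] by blast
  qed (simp add: d_def)
  then have "d \<in> realisations k n t" using dt by (simp add: realisations_def)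
  then have "d \<in> Forb k N F n" using P by blast
  moreover have "pullback N d \<phi> = c"
  proof (rule extensionalityI[where A = "edges N"])
    show "c \<in> extensional (edges N)" using F cF by (auto simp: colourings_def PiE_iff)
    fix e assume e: "e \<in> edges N"
    then show "pullback N d \<phi> e = c e"
      using embedding_image_edge[OF \<phi> e] inj by (simp add: pullback_def d_def inv_into_f_f)
  qed (simp add: pullback_def)
  ultimately show False using \<phi> cF by (auto simp: Forb_def)
qed

text \<open>Supersaturation, read contrapositively, turns few hyperedges inside a container into an
  entropy bound. The exponent \<sigma> stays a parameter because its constraint degenerates for
  \<open>N choose 2 = 1\<close>.\<close>

theorem template_containers:
  assumes k: "k \<ge> 1" and N: "N \<ge> 2" and F: "F \<subseteq> colourings k N" and ne: "\<And>n. Forb k N F n \<noteq> {}"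
    and \<epsilon>: "\<epsilon> > 0" and \<sigma>: "\<sigma> \<ge> 0" "\<sigma> * (real (N choose 2) - 1) \<le> 1"
  shows "\<exists>K\<ge>0. \<exists>n0. \<forall>n\<ge>n0. \<exists>\<T>. finite \<T> \<and> \<T> \<subseteq> templates k n \<and>
    real (card \<T>) \<le> (real k * (real n)\<^sup>2 + 1) powr (K * real n powr (- \<sigma>) * (real k * (real n)\<^sup>2)) \<and>
    (\<forall>t\<in>\<T>. Ent k n t \<le> ex k n (Forb k N F) + \<epsilon> * (real n)\<^sup>2) \<and>
    (\<forall>t'\<in>templates k n. realisations k n t' \<subseteq> Forb k N F n \<longrightarrow> (\<exists>t\<in>\<T>. \<forall>e\<in>edges n. t' e \<subseteq> t e))"
proof -
  define r where "r = N choose 2"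
  have "r > 0" using N by (simp add: r_def)
  then obtain s where s: "r = Suc s" by (cases r) auto
  have finF: "finite F" using F finite_colourings finite_subset by blast
  obtain E where E: "bij_betw E {..<r} (edges N)"
    using ex_bij_betw_nat_finite[OF finite_edges[of N]] by (auto simp: r_def card_edges atLeast0LessThan)
  define M where "M = real (card F) + 1"
  have M: "M > 0" by (simp add: M_def)
  from supersaturation[OF N finF ne \<epsilon>] obtain \<eta> n1 where \<eta>: "\<eta> > 0"
    and ss: "\<And>n t. n \<ge> n1 \<Longrightarrow> t \<in> templates k n \<Longrightarrow> ex k n (Forb k N F) + \<epsilon> * (real n)\<^sup>2 < Ent k n t \<Longrightarrow>
      \<eta> * real n ^ N \<le> real (card (bad_pairs N F n t))" by blast
  \<comment> \<open>Dividing by \<open>k\<close> compensates for the colours counted in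
    \<open>card V\<close>; as \<open>card V\<close> is at most \<open>k * n\<^sup>2 / 2\<close>, a
    container holds at most half of the copies that supersaturation would force.\<close>
  have \<eta>k: "\<eta> / real k > 0" using \<eta> k by simp
  from containers[OF M \<eta>k, of "copy_vertex E" s] obtain K where K: "K \<ge> 0" and
    cont: "\<And>V J Q \<tau>. spread_hypergraph (copy_vertex E) r V J M Q \<tau> \<Longrightarrow>
     (\<exists>\<C>. finite \<C> \<and> real (card \<C>) \<le> real (card V + 1) powr (K * \<tau> * real (card V)) \<and>
        (\<forall>C\<in>\<C>. C \<subseteq> V \<and> real (card (inner (copy_vertex E) r J C)) \<le> \<eta> / real k * Q * real (card V)) \<and>
        (\<forall>I\<subseteq>V. indep_set (copy_vertex E) r J I \<longrightarrow> (\<exists>C\<in>\<C>. I \<subseteq> C)))"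
    unfolding s by blast
  have "\<exists>\<T>. finite \<T> \<and> \<T> \<subseteq> templates k n \<and>
    real (card \<T>) \<le> (real k * (real n)\<^sup>2 + 1) powr (K * real n powr (- \<sigma>) * (real k * (real n)\<^sup>2)) \<and>
    (\<forall>t\<in>\<T>. Ent k n t \<le> ex k n (Forb k N F) + \<epsilon> * (real n)\<^sup>2) \<and>
    (\<forall>t'\<in>templates k n. realisations k n t' \<subseteq> Forb k N F n \<longrightarrow> (\<exists>t\<in>\<T>. \<forall>e\<in>edges n. t' e \<subseteq> t e))"
    if n: "n \<ge> max n1 1" for n
  proof -
    define V where "V = edges n \<times> {1..k}"
    define J where "J = embeddings N n \<times> F"
    define Q where "Q = real n ^ (N - 2)"
    define \<tau> where "\<tau> = real n powr (- \<sigma>)"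
    have n1: "n \<ge> 1" "n \<ge> n1" using n by auto
    have v: "real (card V) \<le> real k * (real n)\<^sup>2 / 2"
    proof -
      have "real (card V) = real k * real (n choose 2)"
        by (simp add: V_def card_cartesian_product card_edges)
      also have "\<dots> \<le> real k * ((real n)\<^sup>2 / 2)"
        using twice_choose_two_le[of n] by (intro mult_left_mono) auto
      finally show ?thesis by simp
    qed
    have "spread_hypergraph (copy_vertex E) r V J M Q \<tau>"
      unfolding spread_hypergraph_def
    proof (intro conjI)
      show "finite V" "finite J" by (auto simp: V_def J_def finF finite_embeddings)
      show "\<forall>j\<in>J. \<forall>a<r. copy_vertex E j a \<in> V"
      proof (intro ballI allI impI)
        fix j a assume j: "j \<in> J" and a: "a < r"
        have Ea: "E a \<in> edges N" using E a by (auto simp: bij_betw_def)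
        have "snd j \<in> F" using j by (auto simp: J_def)
        then have "snd j \<in> edges N \<rightarrow>\<^sub>E {1..k}" using F unfolding colourings_def by blast
        then have "snd j (E a) \<in> {1..k}" using Ea by blast
        then show "copy_vertex E j a \<in> V"
          using embedding_image_edge[OF _ Ea, of "fst j" n] j by (auto simp: V_def J_def copy_vertex_def)
      qed
      show "0 < Q" "0 < \<tau>" using n1 by (auto simp: Q_def \<tau>_def)
      show "\<tau> \<le> 1" using n1 \<sigma> powr_mono[of "- \<sigma>" 0 "real n"] by (simp add: \<tau>_def)
      show "spread (copy_vertex E) r J M Q \<tau>"
        unfolding J_def M_def Q_def \<tau>_def
        using N finF n1 \<sigma> E by (intro spread_copies) (auto simp: r_def)
    qed
    from cont[OF this] obtain \<C> where \<C>: "finite \<C>"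
      "real (card \<C>) \<le> real (card V + 1) powr (K * \<tau> * real (card V))"
      "\<forall>C\<in>\<C>. C \<subseteq> V \<and> real (card (inner (copy_vertex E) r J C)) \<le> \<eta> / real k * Q * real (card V)"
      "\<forall>I\<subseteq>V. indep_set (copy_vertex E) r J I \<longrightarrow> (\<exists>C\<in>\<C>. I \<subseteq> C)"
      by (elim exE conjE)
    define tpl where "tpl C = (\<lambda>e\<in>edges n. {x. (e, x) \<in> C})" for C :: "(nat set \<times> nat) set"
    \<comment> \<open>A container may offer no colour at some edge and then gives no template.
      Dropping it is harmless, since a container that covers a good template has a colour at every
      edge.\<close>
    define \<T> where "\<T> = tpl ` \<C> \<inter> templates k n"
    have "finite \<T>" "\<T> \<subseteq> templates k n" using \<C>(1) by (auto simp: \<T>_def)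
    moreover have "real (card \<T>) \<le> (real k * (real n)\<^sup>2 + 1) powr (K * real n powr (- \<sigma>) * (real k * (real n)\<^sup>2))"
    proof -
      have "card \<T> \<le> card (tpl ` \<C>)" unfolding \<T>_def using \<C>(1) by (intro card_mono) auto
      also have "\<dots> \<le> card \<C>" by (rule card_image_le[OF \<C>(1)])
      finally have "real (card \<T>) \<le> real (card \<C>)" by simp
      also note \<C>(2)
      also have "real (card V + 1) powr (K * \<tau> * real (card V))
          \<le> real (card V + 1) powr (K * \<tau> * (real k * (real n)\<^sup>2))"
        using v K by (intro powr_mono mult_left_mono) (auto simp: \<tau>_def)
      also have "\<dots> \<le> (real k * (real n)\<^sup>2 + 1) powr (K * \<tau> * (real k * (real n)\<^sup>2))"
      proof (rule powr_mono2)
        have "0 \<le> real k * (real n)\<^sup>2" by simp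
        with v show "real (card V + 1) \<le> real k * (real n)\<^sup>2 + 1" by simp
      qed (use K in \<open>auto simp: \<tau>_def\<close>)
      finally show ?thesis by (simp add: \<tau>_def)
    qed
    moreover have "Ent k n t \<le> ex k n (Forb k N F) + \<epsilon> * (real n)\<^sup>2" if t: "t \<in> \<T>" for t
    proof (rule ccontr)
      assume "\<not> ?thesis"
      then have "\<eta> * real n ^ N \<le> real (card (bad_pairs N F n t))"
        using t n1 by (intro ss) (auto simp: \<T>_def)
      moreover from t obtain C where C: "C \<in> \<C>" "t = tpl C" by (auto simp: \<T>_def)
      have "bad_pairs N F n t \<subseteq> inner (copy_vertex E) r J C"
      proof
        fix j assume j: "j \<in> bad_pairs N F n t"
        have "copy_vertex E j a \<in> C" if a: "a < r" for a
        proof -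
          have Ea: "E a \<in> edges N" using E a by (auto simp: bij_betw_def)
          then show ?thesis
            using j embedding_image_edge[OF _ Ea, of "fst j" n]
            by (auto simp: bad_pairs_def copy_vertex_def C tpl_def)
        qed
        then show "j \<in> inner (copy_vertex E) r J C"
          using j by (auto simp: inner_def J_def bad_pairs_def)
      qed
      then have "card (bad_pairs N F n t) \<le> card (inner (copy_vertex E) r J C)"
        by (intro card_mono) (auto simp: inner_def J_def finF finite_embeddings)
      moreover have "real (card (inner (copy_vertex E) r J C)) \<le> \<eta> / real k * Q * real (card V)"
        using \<C>(3) C by blast
      ultimately have "\<eta> * real n ^ N \<le> \<eta> / real k * Q * real (card V)" by linarith
      also have "\<dots> \<le> \<eta> / real k * Q * (real k * (real n)\<^sup>2 / 2)"
        using v \<eta> by (intro mult_left_mono) (auto simp: Q_def)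
      also have "\<dots> = \<eta> * (Q * (real n)\<^sup>2) / 2" using k by simp
      also have "Q * (real n)\<^sup>2 = real n ^ N"
        unfolding Q_def using N by (simp only: le_add_diff_inverse2 flip: power_add)
      finally have "\<eta> * real n ^ N \<le> 0" by simp
      moreover have "\<eta> * real n ^ N > 0" using \<eta> n1 by simp
      ultimately show False by linarith
    qed
    moreover have "\<exists>t\<in>\<T>. \<forall>e\<in>edges n. t' e \<subseteq> t e"
      if t': "t' \<in> templates k n" "realisations k n t' \<subseteq> Forb k N F n" for t'
    proof -
      let ?I = "{(e, x). e \<in> edges n \<and> x \<in> t' e}"
      have "indep_set (copy_vertex E) r J ?I"
        unfolding J_def by (rule indep_set_template[OF t' F E])
      moreover have "?I \<subseteq> V" using template_edge[OF t'(1)] by (fastforce simp: V_def)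
      ultimately obtain C where C: "C \<in> \<C>" "?I \<subseteq> C" using \<C>(4) by blast
      then have CV: "C \<subseteq> V" using \<C>(3) by blast
      have sub: "t' e \<subseteq> tpl C e" if "e \<in> edges n" for e using C(2) that by (auto simp: tpl_def)
      have "tpl C e \<in> Pow {1..k} - {{}}" if e: "e \<in> edges n" for e
        using sub[OF e] template_edge[OF t'(1) e] CV e by (auto simp: tpl_def V_def)
      then have "tpl C \<in> templates k n"
        unfolding templates_def by (intro PiE_I) (auto simp: tpl_def)
      then show ?thesis using sub C by (auto simp: \<T>_def)
    qed
    ultimately show ?thesis by (intro exI[of _ \<T>] conjI ballI impI) simp_all
  qed
  with K show ?thesis by blast
qed

section \<open>Concentration\<close>

lemma recolour_edges:
  assumes mono: "colour_monotone i P" and "c \<in> P n" and "finite D" "D \<subseteq> edges n"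
  shows "(\<lambda>e. if e \<in> D then i else c e) \<in> P n"
  using assms(3,4)
proof (induction D rule: finite_induct)
  case empty
  then show ?case using assms by simp
next
  case (insert x D)
  then have "(\<lambda>e. if e \<in> D then i else c e)(x := i) \<in> P n"
    using mono by (auto simp: colour_monotone_def)
  also have "(\<lambda>e. if e \<in> D then i else c e)(x := i) = (\<lambda>e. if e \<in> insert x D then i else c e)"
    by auto
  finally show ?case .
qed

text \<open>A realisation of the enlarged template arises from one of \<open>t\<close> by
  recolouring with \<open>i\<close> exactly the edges whose colour is not in
  \<open>t\<close>.\<close>

lemma realisations_insert_colour:
  assumes mono: "colour_monotone i P" and t: "t \<in> templates k n"
    and P: "realisations k n t \<subseteq> P n"
  shows "realisations k n (\<lambda>e\<in>edges n. insert i (t e)) \<subseteq> P n"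
proof
  fix c assume c: "c \<in> realisations k n (\<lambda>e\<in>edges n. insert i (t e))"
  then have cc: "c \<in> colourings k n" and ct: "\<And>e. e \<in> edges n \<Longrightarrow> c e = i \<or> c e \<in> t e"
    by (auto simp: realisations_def)
  let ?D = "{e \<in> edges n. c e \<notin> t e}"
  let ?d = "\<lambda>e. if e \<in> ?D then SOME x. x \<in> t e else c e"
  have dt: "?d e \<in> t e" if "e \<in> edges n" for e
  proof -
    have "t e \<noteq> {}" using template_edge[OF t that] by blast
    then show ?thesis using that by (auto simp: some_in_eq)
  qed
  have "?d \<in> colourings k n"
    unfolding colourings_def
  proof
    show "?d e \<in> {1..k}" if "e \<in> edges n" for e
      using dt[OF that] template_edge[OF t that] by blast
    show "?d e = undefined" if "e \<notin> edges n" for e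
      using PiE_arb[OF cc[unfolded colourings_def] that] that by simp
  qed
  then have "?d \<in> P n" using P dt by (auto simp: realisations_def)
  then have "(\<lambda>e. if e \<in> ?D then i else ?d e) \<in> P n"
    by (rule recolour_edges[OF mono]) auto
  also have "(\<lambda>e. if e \<in> ?D then i else ?d e) = c" using ct by fastforce
  finally show "c \<in> P n" .
qed

lemma realisations_mono:
  "(\<And>e. e \<in> edges n \<Longrightarrow> t' e \<subseteq> t e) \<Longrightarrow> realisations k n t' \<subseteq> realisations k n t"
  unfolding realisations_def by blast

section \<open>Relative extremal entropy and random open edges\<close>

lemma finite_ex_rel_values:
  "finite {Ent k n t' | t'. t' \<in> templates k n \<and> (\<forall>e\<in>edges n. t' e \<subseteq> T e) \<and> realisations k n t' \<subseteq> P n}"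
  by (rule finite_subset[of _ "Ent k n ` templates k n"]) (auto simp: finite_templates)

lemma Ent_le_ex_rel:
  assumes "t' \<in> templates k n" "\<And>e. e \<in> edges n \<Longrightarrow> t' e \<subseteq> T e" "realisations k n t' \<subseteq> P n"
  shows "Ent k n t' \<le> ex_rel k n T P"
  unfolding ex_rel_def using assms by (intro Max_ge finite_ex_rel_values) auto

lemma ex_rel_attained:
  assumes "t \<in> templates k n" "\<And>e. e \<in> edges n \<Longrightarrow> t e \<subseteq> T e" "realisations k n t \<subseteq> P n"
  obtains t' where "t' \<in> templates k n" "\<And>e. e \<in> edges n \<Longrightarrow> t' e \<subseteq> T e" "realisations k n t' \<subseteq> P n"
    "Ent k n t' = ex_rel k n T P"
proof -
  let ?X = "{Ent k n t' | t'. t' \<in> templates k n \<and> (\<forall>e\<in>edges n. t' e \<subseteq> T e) \<and> realisations k n t' \<subseteq> P n}"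
  have "?X \<noteq> {}" using assms by blast
  then have "ex_rel k n T P \<in> ?X" unfolding ex_rel_def by (intro Max_in finite_ex_rel_values)
  then show ?thesis using that by auto
qed

text \<open>Edges with \<open>T e = {i}\<close> are closed: every subtemplate has entropy zero
  there. This is a sum of independent terms, ready for Hoeffding's inequality, whereas
  \<open>ex_rel\<close> is a maximum.\<close>

definition open_weight :: "nat \<Rightarrow> nat \<Rightarrow> (nat set \<Rightarrow> real) \<Rightarrow> (nat set \<Rightarrow> nat set) \<Rightarrow> real" where
  "open_weight i n w T = (\<Sum>e\<in>edges n. if T e = {i} then 0 else w e)"

lemma random_template_support:
  assumes "T \<in> set_pmf (random_template k n p i)" "e \<in> edges n"
  shows "T e = {1..k} \<or> T e = {i}"
proof -
  have "set_pmf (random_template k n p i) \<subseteq>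
      PiE_dflt (edges n) undefined (set_pmf \<circ> (\<lambda>e. map_pmf (\<lambda>b. if b then {1..k} else {i}) (bernoulli_pmf p)))"
    unfolding random_template_def by (rule set_Pi_pmf_subset') simp
  with assms have "T e \<in> set_pmf (map_pmf (\<lambda>b. if b then {1..k} else {i}) (bernoulli_pmf p))"
    by (auto simp: PiE_dflt_def)
  then show ?thesis by (auto split: if_splits)
qed

lemma open_weight_concentration:
  assumes i: "i \<in> {1..k}" and p: "0 \<le> p" "p \<le> 1" and n: "n \<ge> 2" and \<delta>: "\<delta> \<ge> 0"
    and w: "\<And>e. e \<in> edges n \<Longrightarrow> 0 \<le> w e \<and> w e \<le> 1" "\<And>e. e \<in> edges n \<Longrightarrow> k = 1 \<Longrightarrow> w e = 0"
  defines "\<mu> \<equiv> p * (\<Sum>e\<in>edges n. w e)"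
  shows "measure_pmf.prob (random_template k n p i) {T. open_weight i n w T \<ge> \<mu> + \<delta>} \<le> exp (- 2 * \<delta>\<^sup>2 / (real n)\<^sup>2)"
    and "measure_pmf.prob (random_template k n p i) {T. open_weight i n w T \<le> \<mu> - \<delta>} \<le> exp (- 2 * \<delta>\<^sup>2 / (real n)\<^sup>2)"
proof -
  let ?M = "random_template k n p i"
  let ?X = "\<lambda>e T. if T e = {i} then 0 else w e"
  have indep: "prob_space.indep_vars (measure_pmf ?M) (\<lambda>_. borel) ?X (edges n)"
  proof -
    have "prob_space.indep_vars (measure_pmf ?M) (\<lambda>_. count_space UNIV) (\<lambda>e T. T e) (edges n)"
      unfolding random_template_def by (rule indep_vars_Pi_pmf) simp
    then show ?thesis
      by (rule prob_space.indep_vars_compose2[OF measure_pmf.prob_space_axioms,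
            where Y = "\<lambda>e S. if S = {i} then 0 else w e"]) auto
  qed
  have E: "measure_pmf.expectation ?M (?X e) = p * w e" if e: "e \<in> edges n" for e
  proof -
    have "measure_pmf.expectation ?M (?X e)
        = measure_pmf.expectation (map_pmf (\<lambda>T. T e) ?M) (\<lambda>S. if S = {i} then 0 else w e)"
      by simp
    also have "map_pmf (\<lambda>T. T e) ?M = map_pmf (\<lambda>b. if b then {1..k} else {i}) (bernoulli_pmf p)"
      unfolding random_template_def using e by (subst Pi_pmf_component) auto
    also have "measure_pmf.expectation \<dots> (\<lambda>S. if S = {i} then 0 else w e)
        = p * (if {1..k} = {i} then 0 else w e)"
      using p by simp
    also have "\<dots> = p * w e"
    \<comment> \<open>For \<open>k = 1\<close> open and closed edges coincide, and the identity
      holds because the weight vanishes.\<close>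
    proof (cases "{1..k} = {i}")
      case True
      then have "k = 1" using i by (metis atLeastAtMost_singleton_iff)
      then show ?thesis using w(2)[OF e] by simp
    next
      case False
      then show ?thesis by (simp only: if_False)
    qed
    finally show ?thesis .
  qed
  interpret H: Hoeffding_ineq "measure_pmf ?M" "edges n" ?X "\<lambda>_. 0" "\<lambda>_. 1"
      "\<Sum>e\<in>edges n. measure_pmf.expectation ?M (?X e)"
  proof unfold_locales
    fix e assume "e \<in> edges n"
    then show "AE T in measure_pmf ?M. ?X e T \<in> {0..1}" using w(1)[of e] by auto
  qed (auto simp: indep)
  have \<mu>: "(\<Sum>e\<in>edges n. measure_pmf.expectation ?M (?X e)) = \<mu>"
    unfolding \<mu>_def sum_distrib_left by (intro sum.cong E refl)
  have c: "(\<Sum>e\<in>edges n. (1 - 0)\<^sup>2) = real (n choose 2)" by (simp add: card_edges)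
  have c0: "real (n choose 2) > 0" using n by simp
  have le: "exp (- 2 * \<delta>\<^sup>2 / real (n choose 2)) \<le> exp (- 2 * \<delta>\<^sup>2 / (real n)\<^sup>2)"
  proof -
    have "real (n choose 2) \<le> (real n)\<^sup>2" using twice_choose_two_le[of n] c0 by linarith
    then have "2 * \<delta>\<^sup>2 / (real n)\<^sup>2 \<le> 2 * \<delta>\<^sup>2 / real (n choose 2)"
      using c0 n by (intro divide_left_mono) auto
    then show ?thesis by simp
  qed
  show "measure_pmf.prob ?M {T. open_weight i n w T \<ge> \<mu> + \<delta>} \<le> exp (- 2 * \<delta>\<^sup>2 / (real n)\<^sup>2)"
    using order_trans[OF H.Hoeffding_ineq_ge[OF \<delta>, unfolded \<mu> c, OF c0] le] by (simp add: open_weight_def)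
  show "measure_pmf.prob ?M {T. open_weight i n w T \<le> \<mu> - \<delta>} \<le> exp (- 2 * \<delta>\<^sup>2 / (real n)\<^sup>2)"
    using order_trans[OF H.Hoeffding_ineq_le[OF \<delta>, unfolded \<mu> c, OF c0] le] by (simp add: open_weight_def)
qed

text \<open>Take \<open>{i}\<close> on closed edges and \<open>insert i (t e)\<close> on open ones:
  monotonicity keeps this inside the property, and no entropy is lost on open edges. The witness
  also shows that the maximum in \<open>ex_rel\<close> is over a nonempty set.\<close>

lemma subtemplate_above_open_weight:
  assumes i: "i \<in> {1..k}" and mono: "colour_monotone i P" and t: "t \<in> templates k n"
    and P: "realisations k n t \<subseteq> P n"
    and T: "\<And>e. e \<in> edges n \<Longrightarrow> T e = {1..k} \<or> T e = {i}"
  obtains t' where "t' \<in> templates k n" "\<And>e. e \<in> edges n \<Longrightarrow> t' e \<subseteq> T e" "realisations k n t' \<subseteq> P n"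
    "open_weight i n (\<lambda>e. log (real k) (real (card (t e)))) T \<le> Ent k n t'"
proof -
  define t' where "t' = (\<lambda>e\<in>edges n. if T e = {i} then {i} else insert i (t e))"
  have te: "t e \<subseteq> {1..k}" "t e \<noteq> {}" if "e \<in> edges n" for e using template_edge[OF t that] by auto
  have "t' \<in> templates k n"
    unfolding templates_def
  proof
    show "t' e \<in> Pow {1..k} - {{}}" if "e \<in> edges n" for e using te[OF that] i that by (auto simp: t'_def)
  qed (simp add: t'_def)
  moreover have "t' e \<subseteq> T e" if "e \<in> edges n" for e
    using T[OF that] te[OF that] i that by (auto simp: t'_def)
  moreover have "realisations k n t' \<subseteq> P n"
    by (rule order_trans[OF realisations_mono realisations_insert_colour[OF mono t P]]) (simp add: t'_def)
  moreover have "open_weight i n (\<lambda>e. log (real k) (real (card (t e)))) T \<le> Ent k n t'"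
    unfolding open_weight_def Ent_def
  proof (rule sum_mono)
    fix e assume e: "e \<in> edges n"
    have "log (real k) (real (card (t e))) \<le> log (real k) (real (card (insert i (t e))))"
      using te[OF e] i by (intro log_card_mono) auto
    then show "(if T e = {i} then 0 else log (real k) (real (card (t e)))) \<le> log (real k) (real (card (t' e)))"
      using e by (simp add: t'_def)
  qed
  ultimately show ?thesis by (rule that)
qed

text \<open>On a closed edge \<open>t' e\<close> can only be \<open>{i}\<close>, of entropy zero;
  elsewhere it is a subset of \<open>t e\<close>. One container \<open>t\<close> thus controls all
  good subtemplates below it.\<close>

lemma Ent_le_open_weight:
  assumes t: "t \<in> templates k n" and t': "t' \<in> templates k n"
    and le: "\<And>e. e \<in> edges n \<Longrightarrow> t' e \<subseteq> t e" "\<And>e. e \<in> edges n \<Longrightarrow> t' e \<subseteq> T e"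
  shows "Ent k n t' \<le> open_weight i n (\<lambda>e. log (real k) (real (card (t e)))) T"
  unfolding open_weight_def Ent_def
proof (rule sum_mono)
  fix e assume e: "e \<in> edges n"
  have te: "t e \<subseteq> {1..k}" "t' e \<noteq> {}" using template_edge[OF t e] template_edge[OF t' e] by auto
  show "log (real k) (real (card (t' e))) \<le> (if T e = {i} then 0 else log (real k) (real (card (t e))))"
  proof (cases "T e = {i}")
    case True
    then have "t' e = {i}" using le(2)[OF e] te(2) by (simp add: subset_singleton_iff)
    then show ?thesis using True by simp
  next
    case False
    then show ?thesis using log_card_mono[OF le(1)[OF e] te(2,1)] by simp
  qed
qed

section \<open>Asymptotics of the union bound\<close>

lemma powr_times_ln_tendsto_0:
  assumes "s > 0" "a \<ge> (0::real)"
  shows "(\<lambda>n. real n powr (- s) * ln (a * (real n)\<^sup>2 + 1)) \<longlonglongrightarrow> 0"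
proof (rule tendsto_sandwich)
  let ?u = "\<lambda>n. ln (a + 1) * real n powr (- s) + 2 * (ln (real n) / real n powr s)"
  show "\<forall>\<^sub>F n in sequentially. 0 \<le> real n powr (- s) * ln (a * (real n)\<^sup>2 + 1)"
    using assms by (intro always_eventually allI mult_nonneg_nonneg ln_ge_zero) auto
  have "(\<lambda>n. real n powr (- s)) \<longlonglongrightarrow> 0"
    using assms by (intro tendsto_neg_powr filterlim_real_sequentially) auto
  then have "?u \<longlonglongrightarrow> ln (a + 1) * 0 + 2 * 0"
    by (intro tendsto_intros lim_ln_over_power assms)
  then show "?u \<longlonglongrightarrow> 0" by simp
  show "\<forall>\<^sub>F n in sequentially. real n powr (- s) * ln (a * (real n)\<^sup>2 + 1) \<le> ?u n"
  proof (rule eventually_mono[OF eventually_ge_at_top[of 1]])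
    fix n :: nat assume n: "n \<ge> 1"
    have n2: "1 \<le> (real n)\<^sup>2" using n by simp
    have "0 < a * (real n)\<^sup>2 + 1" using assms by (intro add_nonneg_pos) auto
    then have "ln (a * (real n)\<^sup>2 + 1) \<le> ln ((a + 1) * (real n)\<^sup>2)"
      using n2 by (intro ln_mono) (auto simp: algebra_simps)
    also have "\<dots> = ln (a + 1) + 2 * ln (real n)"
      using assms n by (simp add: ln_mult ln_realpow)
    finally have "real n powr (- s) * ln (a * (real n)\<^sup>2 + 1) \<le> real n powr (- s) * (ln (a + 1) + 2 * ln (real n))"
      by (intro mult_left_mono) auto
    also have "\<dots> = ?u n" by (simp add: powr_minus divide_inverse algebra_simps)
    finally show "real n powr (- s) * ln (a * (real n)\<^sup>2 + 1) \<le> ?u n" .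
  qed
qed simp

text \<open>With \<open>p n = h n * n powr (- \<rho>)\<close>, both exponents carry the factor
  \<open>n powr (2 - 2 * \<rho>)\<close>. Its coefficient from the container count is
  \<open>n powr (- s)\<close> times a logarithm and tends to 0, since
  \<open>s = \<sigma> - 2 * \<rho>\<close> is positive; the one from Hoeffding's inequality is
  \<open>- 2 * \<epsilon>\<^sup>2 * (h n)\<^sup>2\<close>. Their sum \<open>u\<close> tends to minus
  infinity.\<close>

lemma container_union_bound_tendsto_0:
  fixes p :: "nat \<Rightarrow> real"
  assumes lim: "filterlim (\<lambda>n. p n / real n powr (- \<rho>)) at_top sequentially"
    and \<rho>: "\<rho> \<le> 1" "2 * \<rho> < \<sigma>" and "\<epsilon> > 0" "K \<ge> 0" "a \<ge> 0"
  shows "(\<lambda>n. (a * (real n)\<^sup>2 + 1) powr (K * real n powr (- \<sigma>) * (a * (real n)\<^sup>2)) *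
     exp (- 2 * (\<epsilon> * p n * (real n)\<^sup>2)\<^sup>2 / (real n)\<^sup>2)) \<longlonglongrightarrow> 0"
proof -
  define h where "h n = p n / real n powr (- \<rho>)" for n
  define s where "s = \<sigma> - 2 * \<rho>"
  define u where "u n = K * a * (real n powr (- s) * ln (a * (real n)\<^sup>2 + 1)) - 2 * \<epsilon>\<^sup>2 * (h n)\<^sup>2" for n
  have s: "s > 0" using \<rho> by (simp add: s_def)
  have h: "filterlim h at_top sequentially" using lim by (simp add: h_def[abs_def])
  have m: "filterlim (\<lambda>n. 2 * \<epsilon>\<^sup>2 * (h n)\<^sup>2) at_top sequentially"
    using assms(4) by (intro filterlim_tendsto_pos_mult_at_top[OF tendsto_const] filterlim_pow_at_top h) auto
  have z: "(\<lambda>n. K * a * (real n powr (- s) * ln (a * (real n)\<^sup>2 + 1))) \<longlonglongrightarrow> K * a * 0"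
    by (intro tendsto_intros powr_times_ln_tendsto_0 s assms)
  have u: "filterlim u at_bot sequentially"
    unfolding filterlim_uminus_at_bot
    using filterlim_tendsto_add_at_top[OF tendsto_minus[OF z] m] by (simp add: u_def)
  have lim0: "(\<lambda>n. exp (u n)) \<longlonglongrightarrow> 0"
    by (rule filterlim_compose[OF exp_at_bot u])
  have neg: "\<forall>\<^sub>F n in sequentially. u n \<le> 0"
    using u by (simp add: filterlim_at_bot)
  show ?thesis
  proof (rule tendsto_sandwich[OF _ _ tendsto_const lim0])
    show "\<forall>\<^sub>F n in sequentially. (a * (real n)\<^sup>2 + 1) powr (K * real n powr (- \<sigma>) * (a * (real n)\<^sup>2)) *
       exp (- 2 * (\<epsilon> * p n * (real n)\<^sup>2)\<^sup>2 / (real n)\<^sup>2) \<le> exp (u n)"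
      using neg eventually_ge_at_top[of 1]
    proof eventually_elim
      case (elim n)
      define x where "x = real n"
      have x: "x \<ge> 1" using elim by (simp add: x_def)
      have hp: "p n = h n * x powr (- \<rho>)" using x by (simp add: h_def x_def)
      have pos: "a * x\<^sup>2 + 1 > 0" using assms by (intro add_nonneg_pos) auto
      have sq: "(x powr (- \<rho>))\<^sup>2 * x\<^sup>2 = x powr (2 - 2 * \<rho>)"
      proof -
        have "(x powr (- \<rho>))\<^sup>2 * x\<^sup>2 = x powr (- (2 * \<rho>)) * x powr 2"
          using x by (simp add: powr_power powr_numeral)
        also have "\<dots> = x powr (2 - 2 * \<rho>)" by (simp add: powr_add[symmetric] algebra_simps)
        finally show ?thesis .
      qed
      have sg: "x powr (- \<sigma>) * x\<^sup>2 = x powr (2 - 2 * \<rho>) * x powr (- s)"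
      proof -
        have "x powr (- \<sigma>) * x\<^sup>2 = x powr (- \<sigma>) * x powr 2" using x by (simp add: powr_numeral)
        also have "\<dots> = x powr (2 - 2 * \<rho>) * x powr (- s)"
          by (simp add: powr_add[symmetric] s_def algebra_simps)
        finally show ?thesis .
      qed
      have e1: "(\<epsilon> * p n * x\<^sup>2)\<^sup>2 / x\<^sup>2 = \<epsilon>\<^sup>2 * (h n)\<^sup>2 * x powr (2 - 2 * \<rho>)"
      proof -
        have "(\<epsilon> * p n * x\<^sup>2)\<^sup>2 / x\<^sup>2 = \<epsilon>\<^sup>2 * (p n)\<^sup>2 * x\<^sup>2"
          using x by (simp add: field_simps power2_eq_square)
        also have "\<dots> = \<epsilon>\<^sup>2 * (h n)\<^sup>2 * ((x powr (- \<rho>))\<^sup>2 * x\<^sup>2)"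
          by (simp add: hp power_mult_distrib)
        finally show ?thesis by (simp only: sq)
      qed
      have e2: "K * x powr (- \<sigma>) * (a * x\<^sup>2) = K * a * x powr (- s) * x powr (2 - 2 * \<rho>)"
      proof -
        have "K * x powr (- \<sigma>) * (a * x\<^sup>2) = K * a * (x powr (- \<sigma>) * x\<^sup>2)" by simp
        then show ?thesis unfolding sg by (simp add: mult_ac)
      qed
      have "(a * x\<^sup>2 + 1) powr (K * x powr (- \<sigma>) * (a * x\<^sup>2)) * exp (- 2 * (\<epsilon> * p n * x\<^sup>2)\<^sup>2 / x\<^sup>2)
          = exp (K * x powr (- \<sigma>) * (a * x\<^sup>2) * ln (a * x\<^sup>2 + 1) - 2 * ((\<epsilon> * p n * x\<^sup>2)\<^sup>2 / x\<^sup>2))"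
        using pos by (simp add: powr_def exp_diff exp_minus divide_inverse)
      also have "K * x powr (- \<sigma>) * (a * x\<^sup>2) * ln (a * x\<^sup>2 + 1) - 2 * ((\<epsilon> * p n * x\<^sup>2)\<^sup>2 / x\<^sup>2)
          = x powr (2 - 2 * \<rho>) * u n"
        unfolding e1 e2 u_def x_def[symmetric] by (simp add: algebra_simps)
      \<comment> \<open>The factor is at least 1 because \<rho> \<le> 1, and \<open>u n\<close> is
        nonpositive.\<close>
      also have "\<dots> \<le> 1 * u n"
        using elim(1) x \<rho> by (intro mult_right_mono_neg ge_one_powr_ge_zero) auto
      finally show ?case by (simp add: x_def)
    qed
  qed (auto intro!: always_eventually)
qed

text \<open>On failure either an optimal template has open weight at least \<delta> below its mean
  or some container has it at least \<delta> above. These are \<open>1 + card \<T>\<close> events of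
  probability at most \<open>q\<close>, and \<open>B \<ge> 1\<close> merges them into
  \<open>2 * (B * q)\<close>.\<close>

lemma deviation_probability_le:
  fixes p \<epsilon> :: real
  assumes i: "i \<in> {1..k}" and mono: "colour_monotone i P" and PnE: "P n \<noteq> {}" "P n \<subseteq> colourings k n"
    and p: "0 \<le> p" "p \<le> 1" and n: "n \<ge> 2" and \<epsilon>: "\<epsilon> > 0"
    and \<T>: "finite \<T>" "\<T> \<subseteq> templates k n" "real (card \<T>) \<le> B" "B \<ge> 1"
      "\<And>t. t \<in> \<T> \<Longrightarrow> Ent k n t \<le> ex k n P + \<epsilon> * (real n)\<^sup>2"
      "\<And>t'. t' \<in> templates k n \<Longrightarrow> realisations k n t' \<subseteq> P n \<Longrightarrow> \<exists>t\<in>\<T>. \<forall>e\<in>edges n. t' e \<subseteq> t e"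
  shows "1 - 2 * (B * exp (- 2 * (\<epsilon> * p * (real n)\<^sup>2)\<^sup>2 / (real n)\<^sup>2)) \<le>
    measure_pmf.prob (random_template k n p i)
      {T. p * (ex k n P - \<epsilon> * (real n)\<^sup>2) \<le> ex_rel k n T P \<and> ex_rel k n T P \<le> p * (ex k n P + 2 * \<epsilon> * (real n)\<^sup>2)}"
proof -
  let ?M = "random_template k n p i"
  let ?A = "{T. p * (ex k n P - \<epsilon> * (real n)\<^sup>2) \<le> ex_rel k n T P \<and> ex_rel k n T P \<le> p * (ex k n P + 2 * \<epsilon> * (real n)\<^sup>2)}"
  \<comment> \<open>The entropy surplus of a container costs
    \<open>\<epsilon> * p * n\<^sup>2\<close> and the deviation as much again; together they make up
    the \<open>2 * \<epsilon>\<close> of the upper bound.\<close>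
  define \<delta> where "\<delta> = \<epsilon> * p * (real n)\<^sup>2"
  define q where "q = exp (- 2 * \<delta>\<^sup>2 / (real n)\<^sup>2)"
  define w where "w t e = log (real k) (real (card (t e)))" for t :: "nat set \<Rightarrow> nat set" and e
  have \<delta>: "\<delta> \<ge> 0" using \<epsilon> p by (simp add: \<delta>_def)
  obtain c where "c \<in> P n" using PnE by blast
  then obtain t0 where t0: "t0 \<in> templates k n" "realisations k n t0 \<subseteq> P n" "Ent k n t0 = ex k n P"
    using ex_attained PnE(2) by metis
  have w: "0 \<le> w t e \<and> w t e \<le> 1" "k = 1 \<Longrightarrow> w t e = 0" if "t \<in> templates k n" "e \<in> edges n" for t e
    using log_card_bounds[OF template_edge[OF that]] by (auto simp: w_def log_def)
  have Ew: "(\<Sum>e\<in>edges n. w t e) = Ent k n t" for t by (simp add: Ent_def w_def)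
  let ?L = "{T. open_weight i n (w t0) T \<le> p * Ent k n t0 - \<delta>}"
  let ?U = "\<lambda>t. {T. open_weight i n (w t) T \<ge> p * Ent k n t + \<delta>}"
  \<comment> \<open>Only on the support is each \<open>T e\<close> known to be \<open>{1..k}\<close>
    or \<open>{i}\<close>.\<close>
  have "- ?A \<inter> set_pmf ?M \<subseteq> ?L \<union> (\<Union>t\<in>\<T>. ?U t)"
  proof
    fix T assume T: "T \<in> - ?A \<inter> set_pmf ?M"
    have supp: "T e = {1..k} \<or> T e = {i}" if "e \<in> edges n" for e
      using random_template_support[of T k n p i e] T that by blast
    obtain t1 where t1: "t1 \<in> templates k n" "\<And>e. e \<in> edges n \<Longrightarrow> t1 e \<subseteq> T e"
      "realisations k n t1 \<subseteq> P n" "open_weight i n (w t0) T \<le> Ent k n t1"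
      using subtemplate_above_open_weight[where P = P and T = T, OF i mono t0(1,2) supp] unfolding w_def by blast
    have lower: "open_weight i n (w t0) T \<le> ex_rel k n T P"
      using t1(4) Ent_le_ex_rel[of t1 k n T P, OF t1(1-3)] by linarith
    obtain t' where t': "t' \<in> templates k n" "\<And>e. e \<in> edges n \<Longrightarrow> t' e \<subseteq> T e" "realisations k n t' \<subseteq> P n"
      "Ent k n t' = ex_rel k n T P"
      using ex_rel_attained[of t1 k n T P, OF t1(1-3)] by blast
    obtain t where t: "t \<in> \<T>" "\<And>e. e \<in> edges n \<Longrightarrow> t' e \<subseteq> t e" using \<T>(6)[OF t'(1,3)] by blast
    have "ex_rel k n T P \<le> open_weight i n (w t) T"
      using Ent_le_open_weight[of t k n t' T i] t t' \<T>(2) by (auto simp: w_def[abs_def])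
    moreover have "p * Ent k n t \<le> p * (ex k n P + \<epsilon> * (real n)\<^sup>2)"
      using \<T>(5)[OF t(1)] p by (intro mult_left_mono) auto
    moreover have "ex_rel k n T P < p * (ex k n P - \<epsilon> * (real n)\<^sup>2) \<or> ex_rel k n T P > p * (ex k n P + 2 * \<epsilon> * (real n)\<^sup>2)"
      using T by auto
    ultimately have "open_weight i n (w t0) T \<le> p * Ent k n t0 - \<delta> \<or> open_weight i n (w t) T \<ge> p * Ent k n t + \<delta>"
      using lower t0(3) by (auto simp: \<delta>_def algebra_simps)
    then show "T \<in> ?L \<union> (\<Union>t\<in>\<T>. ?U t)" using t(1) by blast
  qed
  then have "measure_pmf.prob ?M (- ?A \<inter> set_pmf ?M) \<le> measure_pmf.prob ?M (?L \<union> (\<Union>t\<in>\<T>. ?U t))"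
    by (intro measure_pmf.finite_measure_mono) auto
  then have "measure_pmf.prob ?M (- ?A) \<le> measure_pmf.prob ?M (?L \<union> (\<Union>t\<in>\<T>. ?U t))"
    by (simp only: measure_Int_set_pmf)
  also have "\<dots> \<le> measure_pmf.prob ?M ?L + measure_pmf.prob ?M (\<Union>t\<in>\<T>. ?U t)"
    by (intro measure_Un_le) auto
  also have "measure_pmf.prob ?M ?L \<le> q"
    using open_weight_concentration(2)[OF i p n \<delta>, of "w t0"] w t0(1) unfolding Ew q_def by blast
  also have "measure_pmf.prob ?M (\<Union>t\<in>\<T>. ?U t) \<le> (\<Sum>t\<in>\<T>. measure_pmf.prob ?M (?U t))"
    by (intro measure_pmf.finite_measure_subadditive_finite \<T>) auto
  also have "\<dots> \<le> (\<Sum>t\<in>\<T>. q)"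
  proof (rule sum_mono)
    fix t assume "t \<in> \<T>"
    then have "t \<in> templates k n" using \<T> by blast
    then show "measure_pmf.prob ?M (?U t) \<le> q"
      using open_weight_concentration(1)[OF i p n \<delta>, of "w t"] w unfolding Ew q_def by blast
  qed
  also have "(\<Sum>t\<in>\<T>. q) \<le> B * q" using \<T>(3) by (simp add: q_def)
  finally have "measure_pmf.prob ?M (- ?A) \<le> q + B * q" by simp
  moreover have "q \<le> B * q" using \<T>(4) by (simp add: q_def)
  moreover have "measure_pmf.prob ?M (- ?A) = 1 - measure_pmf.prob ?M ?A"
    using measure_pmf.prob_compl[of ?A ?M] by (simp add: Compl_eq_Diff_UNIV)
  ultimately show ?thesis unfolding q_def \<delta>_def by linarith
qed

theorem theorem2p23:
  fixes k i N :: nat and F :: "(nat set \<Rightarrow> nat) set" and p :: "nat \<Rightarrow> real" and \<epsilon> :: real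
  assumes "i \<in> {1..k}"
    and "N \<ge> 2"
    and "F \<subseteq> colourings k N"
    and "colour_monotone i (Forb k N F)"
    and "\<And>n. Forb k N F n \<noteq> {}"
    and "\<And>n. 0 \<le> p n \<and> p n \<le> 1"
    and "filterlim (\<lambda>n. p n / real n powr (- 1 / (2 * real (N choose 2) - 1))) at_top sequentially"
    and "\<epsilon> > 0"
  shows "(\<lambda>n. measure_pmf.prob (random_template k n (p n) i)
            {T. p n * (ex k n (Forb k N F) - \<epsilon> * (real n)\<^sup>2) \<le> ex_rel k n T (Forb k N F)
              \<and> ex_rel k n T (Forb k N F) \<le> p n * (ex k n (Forb k N F) + 2 * \<epsilon> * (real n)\<^sup>2)})
         \<longlonglongrightarrow> 1"
proof -
  define r where "r = real (N choose 2)"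
  define \<rho> where "\<rho> = 1 / (2 * r - 1)"
  define \<sigma> where "\<sigma> = (if N choose 2 = 1 then 3 else 1 / (r - 1))"
    \<comment> \<open>for \<open>N = 2\<close> there is no codegree condition, and any exponent above 2 will do\<close>
  have "N choose 2 > 0" using assms(2) by simp
  then have "N choose 2 = 1 \<or> N choose 2 \<ge> 2" by linarith
  then have r: "r = 1 \<or> r \<ge> 2" "r = 1 \<longleftrightarrow> N choose 2 = 1" by (auto simp: r_def)
  \<comment> \<open>For \<open>r \<ge> 2\<close> the second inequality amounts to
    \<open>2 * (r - 1) < 2 * r - 1\<close>; for \<open>r = 1\<close> the values are
    \<open>\<rho> = 1\<close> and \<open>\<sigma> = 3\<close>.\<close>
  have \<rho>: "\<rho> \<le> 1" "2 * \<rho> < \<sigma>" and \<sigma>: "\<sigma> \<ge> 0" "\<sigma> * (r - 1) \<le> 1"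
    using r by (auto simp: \<rho>_def \<sigma>_def field_simps)
  have k: "k \<ge> 1" using assms(1) by auto
  from template_containers[OF k assms(2,3,5,8) \<sigma>[unfolded r_def]] obtain K n0 where K: "K \<ge> 0" and
    cont: "\<And>n. n \<ge> n0 \<Longrightarrow> \<exists>\<T>. finite \<T> \<and> \<T> \<subseteq> templates k n \<and>
      real (card \<T>) \<le> (real k * (real n)\<^sup>2 + 1) powr (K * real n powr (- \<sigma>) * (real k * (real n)\<^sup>2)) \<and>
      (\<forall>t\<in>\<T>. Ent k n t \<le> ex k n (Forb k N F) + \<epsilon> * (real n)\<^sup>2) \<and>
      (\<forall>t'\<in>templates k n. realisations k n t' \<subseteq> Forb k N F n \<longrightarrow> (\<exists>t\<in>\<T>. \<forall>e\<in>edges n. t' e \<subseteq> t e))"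
    by blast
  define B where "B n = (real k * (real n)\<^sup>2 + 1) powr (K * real n powr (- \<sigma>) * (real k * (real n)\<^sup>2))" for n
  let ?q = "\<lambda>n. B n * exp (- 2 * (\<epsilon> * p n * (real n)\<^sup>2)\<^sup>2 / (real n)\<^sup>2)"
  have "filterlim (\<lambda>n. p n / real n powr (- \<rho>)) at_top sequentially"
    using assms(7) by (simp add: \<rho>_def r_def)
  then have "?q \<longlonglongrightarrow> 0"
    unfolding B_def using \<rho> assms(8) K by (intro container_union_bound_tendsto_0) auto
  then have "(\<lambda>n. 1 - 2 * ?q n) \<longlonglongrightarrow> 1 - 2 * 0" by (intro tendsto_intros)
  then have lim: "(\<lambda>n. 1 - 2 * ?q n) \<longlonglongrightarrow> 1" by simp
  show ?thesis
  proof (rule tendsto_sandwich[OF _ _ lim tendsto_const])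
    show "\<forall>\<^sub>F n in sequentially. 1 - 2 * ?q n \<le> measure_pmf.prob (random_template k n (p n) i)
            {T. p n * (ex k n (Forb k N F) - \<epsilon> * (real n)\<^sup>2) \<le> ex_rel k n T (Forb k N F)
              \<and> ex_rel k n T (Forb k N F) \<le> p n * (ex k n (Forb k N F) + 2 * \<epsilon> * (real n)\<^sup>2)}"
      using eventually_ge_at_top[of "max n0 2"]
    proof eventually_elim
      case (elim n)
      then obtain \<T> where \<T>: "finite \<T>" "\<T> \<subseteq> templates k n" "real (card \<T>) \<le> B n"
        "\<forall>t\<in>\<T>. Ent k n t \<le> ex k n (Forb k N F) + \<epsilon> * (real n)\<^sup>2"
        "\<forall>t'\<in>templates k n. realisations k n t' \<subseteq> Forb k N F n \<longrightarrow> (\<exists>t\<in>\<T>. \<forall>e\<in>edges n. t' e \<subseteq> t e)"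
        using cont[of n] unfolding B_def by auto
      have "B n \<ge> 1" unfolding B_def using K by (intro ge_one_powr_ge_zero) auto
      with \<T> elim show ?case
        using assms(1,4,5,6,8) Forb_subset by (intro deviation_probability_le) auto
    qed
  qed (auto intro!: always_eventually)
qed

end
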